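(* Suppose $p>0$, $\alpha>-1$, and $f$ is analytic in $\mathbb{D}$. Then the following conditions are equivalent. (a) $f$ belongs to $A^p_\alpha$. (b) There exists a continuous function $g$ in $L^p(\mathbb{D},dA_\alpha)$ such that $$|f(z)-f(w)|\le\rho(z,w)\,(g(z)+g(w))$$ for all $z$ and $w$ in $\mathbb{D}$. (c) There exists a continuous function $g$ in $L^p(\mathbb{D},dA_\alpha)$ such that $$|f(z)-f(w)|\le\beta(z,w)\,(g(z)+g(w))$$ for all $z$ and $w$ in $\mathbb{D}$. (d) There exists a continuous function $g$ in $L^p(\mathbb{D},dA_{p+\alpha})$ such that $$|f(z)-f(w)|\le|z-w|\,(g(z)+g(w))$$ for all $z$ and $w$ in $\mathbb{D}$.
   Context: $\mathbb{D}$ is the open unit disk in $\mathbb{C}$, and $dA$ is the normalized area measure on $\mathbb{D}$ (so $A(\mathbb{D})=1$). For $\alpha>-1$, $dA_\alpha(z)=(\alpha+1)(1-|z|^2)^\alpha\,dA(z)$, a probability measure on $\mathbb{D}$. For $p>0$ and $\alpha>-1$, the weighted Bergman space $A^p_\alpha$ is the space of analytic functions $f$ in $\mathbb{D}$ with $\int_{\mathbb{D}}|f(z)|^p\,dA_\alpha(z)<\infty$. For any $p>0$ (including $p<1$), $g\in L^p(\mathbb{D},d\mu)$ means $\int_{\mathbb{D}}|g|^p\,d\mu<\infty$. The functions $g$ in conditions (b)--(d) are real-valued. The pseudo-hyperbolic metric on $\mathbb{D}$ is $\rho(z,w)=\left|\frac{z-w}{1-\overline{z}w}\right|$, and the hyperbolic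 metric on $\mathbb{D}$ is $\beta(z,w)=\frac12\log\frac{1+\rho(z,w)}{1-\rho(z,w)}$. *)

theory Defs
  imports "HOL-Analysis.Analysis"
begin

abbreviation unit_disk :: "complex set" where
  "unit_disk \<equiv> ball 0 1"

definition disk_area :: "complex measure" where
  "disk_area = density (restrict_space lborel unit_disk) (\<lambda>_. ennreal (1 / pi))"

lemma emeasure_disk_area: "emeasure disk_area unit_disk = 1"
proof -
  have "emeasure lborel unit_disk = ennreal pi"
    by (simp add: emeasure_ball unit_ball_vol_2)
  moreover have "emeasure (restrict_space lborel unit_disk) unit_disk = emeasure lborel unit_disk"
    by (simp add: emeasure_restrict_space)
  moreover have "emeasure disk_area unit_disk
      = ennreal (1 / pi) * emeasure (restrict_space lborel unit_disk) unit_disk"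
    unfolding disk_area_def
    by (subst emeasure_density_const) (auto simp: sets_restrict_space)
  ultimately show ?thesis
    by (simp flip: ennreal_mult)
qed

definition weighted_disk_area :: "real \<Rightarrow> complex measure" where
  "weighted_disk_area \<alpha> =
     density disk_area (\<lambda>z. ennreal ((\<alpha> + 1) * (1 - (cmod z)\<^sup>2) powr \<alpha>))"

text \<open>\<open>L\<^sup>p\<close> is needed for all \<open>p > 0\<close>, including \<open>p < 1\<close>, where the integral below does not
  come from a norm.\<close>

definition in_Lp :: "'a measure \<Rightarrow> real \<Rightarrow> ('a \<Rightarrow> 'b::real_normed_vector) \<Rightarrow> bool" where
  "in_Lp M p g \<longleftrightarrow>
     g \<in> borel_measurable M \<and> (\<integral>\<^sup>+ z. ennreal (norm (g z) powr p) \<partial>M) < \<infinity>"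

text \<open>The members are functions on the whole plane; only their restriction to the disk matters.\<close>

definition bergman_space :: "real \<Rightarrow> real \<Rightarrow> (complex \<Rightarrow> complex) set" where
  "bergman_space p \<alpha> = {f. f analytic_on unit_disk \<and> in_Lp (weighted_disk_area \<alpha>) p f}"

definition pseudo_hyperbolic_dist :: "complex \<Rightarrow> complex \<Rightarrow> real" where
  "pseudo_hyperbolic_dist z w = cmod ((z - w) / (1 - cnj z * w))"

definition hyperbolic_dist :: "complex \<Rightarrow> complex \<Rightarrow> real" where
  "hyperbolic_dist z w =
     1 / 2 * ln ((1 + pseudo_hyperbolic_dist z w) / (1 - pseudo_hyperbolic_dist z w))"

end

theory Submission
  imports Defs "HOL-Complex_Analysis.Cauchy_Integral_Formula"
begin

text \<open>
Write \<open>\<rho>\<close> and \<open>\<beta>\<close> for the two metrics, and say that \<open>g\<close> dominates \<open>f\<close> for a metric \<open>\<delta>\<close> if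
\<open>|f(z) - f(w)| \<le> \<delta>(z, w) (g(z) + g(w))\<close> on the disk.

From the Bergman space to the inequalities. A multiple of the local supremum
\<open>g(z) = sup {|f(w)|. |w - z| \<le> (1 - |z|) / 2}\<close> dominates \<open>f\<close> for \<open>\<rho>\<close>: for close points by Cauchy's
inequality, for distant ones trivially. The point is that \<open>g\<close> is still in \<open>L\<^sup>p\<close>, also for \<open>p < 1\<close>. It
follows from a bound of \<open>|f(z)|\<^sup>p\<close> by a multiple of the mean of \<open>|f|\<^sup>p\<close> over a disc around \<open>z\<close>
(\<open>holomorphic_power_area_bound\<close>) and Tonelli's theorem (\<open>local_sup_in_Lp\<close>). Since \<open>\<rho> \<le> \<beta>\<close>, the same \<open>g\<close>
works for \<open>\<beta>\<close>; since \<open>\<rho>(z, w)\<close> is at most \<open>|z - w| / (1 - |z|)\<close> and at most \<open>|z - w| / (1 - |w|)\<close>,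
the function \<open>g(z) / (1 - |z|)\<close> works for the Euclidean metric, and it lies in \<open>L\<^sup>p\<close> for the exponent
\<open>p + \<alpha>\<close>.

From the inequalities back to the Bergman space. Compare \<open>f\<close> at \<open>r v\<close> and \<open>(2 r - 1) v\<close>, where
\<open>|v| = 1\<close> and \<open>1/2 \<le> r < 1\<close>. For \<open>\<rho>\<close> and \<open>\<beta>\<close> these points have distance at most 1, and their
Euclidean distance is \<open>1 - r\<close>. So each of the three inequalities bounds \<open>|f(r v) - f((2 r - 1) v)|\<close> by
\<open>G(r v) + G((2 r - 1) v)\<close> with \<open>G\<close> in \<open>L\<^sup>p\<close> for the exponent \<open>\<alpha>\<close>. The substitution \<open>r \<mapsto> 2 r - 1\<close>
multiplies \<open>(1 - r)\<^sup>\<alpha> dr\<close> by a factor less than 1, because \<open>\<alpha> > -1\<close>. On each ray the integral of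
\<open>|f|\<^sup>p\<close> is therefore at most a fraction of itself plus an integral of \<open>G\<^sup>p\<close>
(\<open>radial_hardy_inequality\<close>). The rays are put together by polar coordinates
(\<open>nn_integral_complex_radial\<close>).
\<close>

section \<open>Weighted integrals over the disk\<close>

text \<open>The weight \<open>(1 - |z|)\<^sup>\<alpha>\<close> replaces \<open>(\<alpha> + 1) (1 - |z|\<^sup>2)\<^sup>\<alpha> / \<pi>\<close>: their quotient is
bounded and bounded away from 0, and the former is the one that transforms well under \<open>1 - r \<mapsto> 2 (1 - r)\<close>. The integral
lives on the plane with an indicator, so that Tonelli's theorem and dilations apply to it.\<close>

definition disk_Lp_integral :: "real \<Rightarrow> real \<Rightarrow> (complex \<Rightarrow> 'b::real_normed_vector) \<Rightarrow> ennreal" where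
  "disk_Lp_integral p \<alpha> g =
     (\<integral>\<^sup>+z. ennreal (norm (g z) powr p * (1 - cmod z) powr \<alpha>) * indicator unit_disk z \<partial>lborel)"

lemma borel_measurable_on_disk:
  assumes "continuous_on unit_disk (h :: complex \<Rightarrow> real)"
  shows "(\<lambda>z. ennreal (h z) * indicator unit_disk z) \<in> borel_measurable borel"
proof -
  have "(\<lambda>z. ennreal (indicator unit_disk z *\<^sub>R h z)) \<in> borel_measurable borel"
    using borel_measurable_continuous_on_indicator[OF _ assms] by simp
  then show ?thesis
    by (rule measurable_cong[THEN iffD1, rotated]) (auto simp: indicator_def)
qed

lemma continuous_on_disk_weight:
  assumes "0 < p" "continuous_on unit_disk (g :: complex \<Rightarrow> 'b::real_normed_vector)"
  shows "continuous_on unit_disk (\<lambda>z. norm (g z) powr p * (1 - cmod z) powr \<alpha>)"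
  using assms by (intro continuous_intros continuous_on_powr') auto

text \<open>The sign of the exponent is absorbed by its absolute value, so that weights of positive and of
negative exponent can be compared at nearby points in the same way.\<close>

lemma powr_between:
  fixes c s t \<gamma> :: real
  assumes "1 \<le> c" "0 < s" "0 < t" "s \<le> c * t" "t \<le> c * s"
  shows "s powr \<gamma> \<le> c powr \<bar>\<gamma>\<bar> * t powr \<gamma>"
proof (cases "0 \<le> \<gamma>")
  case True
  then have "s powr \<gamma> \<le> (c * t) powr \<gamma>" using assms by (intro powr_mono2) auto
  then show ?thesis using assms True by (simp add: powr_mult)
next
  case False
  then have "s powr \<gamma> \<le> (t / c) powr \<gamma>"
    using assms by (intro powr_mono2') (auto simp: field_simps)
  also have "\<dots> = c powr \<bar>\<gamma>\<bar> * t powr \<gamma>"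
    using assms False by (simp add: powr_divide powr_minus_divide)
  finally show ?thesis .
qed

lemma nn_integral_finite_if_le_cmult:
  assumes "(\<integral>\<^sup>+x. G x \<partial>M) < \<infinity>" "G \<in> borel_measurable M"
    and "\<And>x. x \<in> space M \<Longrightarrow> F x \<le> ennreal c * G x"
  shows "(\<integral>\<^sup>+x. F x \<partial>M) < \<infinity>"
proof -
  have "(\<integral>\<^sup>+x. F x \<partial>M) \<le> (\<integral>\<^sup>+x. ennreal c * G x \<partial>M)"
    using assms(3) by (rule nn_integral_mono)
  also have "\<dots> = ennreal c * (\<integral>\<^sup>+x. G x \<partial>M)"
    using assms(2) by (rule nn_integral_cmult)
  also have "\<dots> < \<infinity>" using assms(1) by (simp add: ennreal_mult_less_top)
  finally show ?thesis .
qed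

lemma in_Lp_weighted_disk_area_iff:
  fixes g :: "complex \<Rightarrow> 'b::real_normed_vector"
  assumes p: "0 < p" and \<alpha>: "-1 < \<alpha>" and g: "continuous_on unit_disk g"
  shows "in_Lp (weighted_disk_area \<alpha>) p g \<longleftrightarrow> disk_Lp_integral p \<alpha> g < \<infinity>"
proof -
  define \<kappa> where "\<kappa> = (\<alpha> + 1) / pi"
  have \<kappa>: "0 < \<kappa>" using \<alpha> by (simp add: \<kappa>_def)
  let ?R = "restrict_space (lborel::complex measure) unit_disk"
  let ?w = "\<lambda>z. (\<alpha> + 1) * (1 - (cmod z)\<^sup>2) powr \<alpha>"
  have sets: "sets (weighted_disk_area \<alpha>) = sets (restrict_space borel unit_disk)"
    by (simp add: weighted_disk_area_def disk_area_def sets_restrict_space)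
  have meas: "g \<in> borel_measurable (weighted_disk_area \<alpha>)"
    using borel_measurable_continuous_on_restrict[OF g] measurable_cong_sets[OF sets] by blast
  have meas1: "(\<lambda>z. ennreal (norm (g z) powr p * (1 - cmod z) powr \<alpha>) * indicator unit_disk z)
      \<in> borel_measurable lborel"
    using borel_measurable_on_disk[OF continuous_on_disk_weight[OF p g]] by simp
  have cont2: "continuous_on unit_disk (\<lambda>z. norm (g z) powr p * (1 - (cmod z)\<^sup>2) powr \<alpha>)"
  proof -
    have "1 - (cmod z)\<^sup>2 \<noteq> 0" if "z \<in> unit_disk" for z
      using that norm_ge_zero[of z] by (auto simp: power2_eq_1_iff simp del: norm_ge_zero)
    then show ?thesis using p g by (intro continuous_intros continuous_on_powr') auto
  qed
  then have meas2: "(\<lambda>z. ennreal (norm (g z) powr p * (1 - (cmod z)\<^sup>2) powr \<alpha>) * indicator unit_disk z)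
      \<in> borel_measurable lborel"
    using borel_measurable_on_disk by simp
  have sq: "1 - cmod z \<le> 1 - (cmod z)\<^sup>2 \<and> 1 - (cmod z)\<^sup>2 \<le> 2 * (1 - cmod z) \<and> 0 < 1 - cmod z"
    if "z \<in> unit_disk" for z
  proof -
    have "1 - (cmod z)\<^sup>2 = (1 - cmod z) * (1 + cmod z)"
      by (simp add: power2_eq_square algebra_simps)
    moreover have "(1 - cmod z) * 1 \<le> (1 - cmod z) * (1 + cmod z)"
      "(1 - cmod z) * (1 + cmod z) \<le> (1 - cmod z) * 2"
      by (rule mult_left_mono; use that in simp)+
    ultimately show ?thesis using that by auto
  qed
  have "(\<integral>\<^sup>+z. ennreal (norm (g z) powr p) \<partial>weighted_disk_area \<alpha>)
      = (\<integral>\<^sup>+z. ennreal (?w z) * ennreal (norm (g z) powr p) \<partial>disk_area)"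
    unfolding weighted_disk_area_def
  proof (rule nn_integral_density)
    show "(\<lambda>x. ennreal (?w x)) \<in> borel_measurable disk_area"
      unfolding disk_area_def measurable_density_eq1
      by (rule measurable_restrict_space1) measurable
    show "(\<lambda>x. ennreal (norm (g x) powr p)) \<in> borel_measurable disk_area"
      using meas unfolding weighted_disk_area_def by simp
  qed
  also have "\<dots> = (\<integral>\<^sup>+z. ennreal (1/pi) * (ennreal (?w z) * ennreal (norm (g z) powr p)) \<partial>?R)"
    unfolding disk_area_def
  proof (rule nn_integral_density)
    have "(\<lambda>x. ennreal (norm (g x) powr p)) \<in> borel_measurable ?R"
      using meas unfolding weighted_disk_area_def disk_area_def by simp
    moreover have "(\<lambda>x. ennreal (?w x)) \<in> borel_measurable ?R"
      by (rule measurable_restrict_space1) measurable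
    ultimately show "(\<lambda>z. ennreal (?w z) * ennreal (norm (g z) powr p)) \<in> borel_measurable ?R"
      by simp
  qed simp
  also have "\<dots> = (\<integral>\<^sup>+z. ennreal (1/pi) * (ennreal (?w z) * ennreal (norm (g z) powr p)) * indicator unit_disk z \<partial>lborel)"
    by (rule nn_integral_restrict_space) simp
  also have "\<dots> = (\<integral>\<^sup>+z. ennreal \<kappa> *
      (ennreal (norm (g z) powr p * (1 - (cmod z)\<^sup>2) powr \<alpha>) * indicator unit_disk z) \<partial>lborel)"
    using \<alpha> unfolding \<kappa>_def by (intro nn_integral_cong) (auto simp: indicator_def mult_ac simp flip: ennreal_mult)
  also have "\<dots> = ennreal \<kappa> *
      (\<integral>\<^sup>+z. ennreal (norm (g z) powr p * (1 - (cmod z)\<^sup>2) powr \<alpha>) * indicator unit_disk z \<partial>lborel)"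
    using meas2 by (rule nn_integral_cmult)
  finally have "in_Lp (weighted_disk_area \<alpha>) p g \<longleftrightarrow>
      (\<integral>\<^sup>+z. ennreal (norm (g z) powr p * (1 - (cmod z)\<^sup>2) powr \<alpha>) * indicator unit_disk z \<partial>lborel) < \<infinity>"
    using meas \<kappa> by (auto simp: in_Lp_def ennreal_mult_less_top)
  also have "\<dots> \<longleftrightarrow> disk_Lp_integral p \<alpha> g < \<infinity>"
    unfolding disk_Lp_integral_def
  proof (intro iffI)
    have *: "ennreal (norm (g z) powr p * s) * indicator unit_disk z
       \<le> ennreal (2 powr \<bar>\<alpha>\<bar>) * (ennreal (norm (g z) powr p * t) * indicator unit_disk z)"
      if "z \<in> unit_disk \<Longrightarrow> s \<le> 2 powr \<bar>\<alpha>\<bar> * t" "0 \<le> t" for z s t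
      using that
      by (auto simp: indicator_def ennreal_mult[symmetric] mult.left_commute intro!: ennreal_leI mult_left_mono)
    have w1: "(1 - cmod z) powr \<alpha> \<le> 2 powr \<bar>\<alpha>\<bar> * (1 - (cmod z)\<^sup>2) powr \<alpha>"
      and w2: "(1 - (cmod z)\<^sup>2) powr \<alpha> \<le> 2 powr \<bar>\<alpha>\<bar> * (1 - cmod z) powr \<alpha>"
      if "z \<in> unit_disk" for z
      by (rule powr_between; use sq[OF that] in auto)+
    show "(\<integral>\<^sup>+z. ennreal (norm (g z) powr p * (1 - cmod z) powr \<alpha>) * indicator unit_disk z \<partial>lborel) < \<infinity>"
      if "(\<integral>\<^sup>+z. ennreal (norm (g z) powr p * (1 - (cmod z)\<^sup>2) powr \<alpha>) * indicator unit_disk z \<partial>lborel) < \<infinity>"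
      by (rule nn_integral_finite_if_le_cmult[OF that meas2 *[OF w1]]) auto
    show "(\<integral>\<^sup>+z. ennreal (norm (g z) powr p * (1 - (cmod z)\<^sup>2) powr \<alpha>) * indicator unit_disk z \<partial>lborel) < \<infinity>"
      if "(\<integral>\<^sup>+z. ennreal (norm (g z) powr p * (1 - cmod z) powr \<alpha>) * indicator unit_disk z \<partial>lborel) < \<infinity>"
      by (rule nn_integral_finite_if_le_cmult[OF that meas1 *[OF w2]]) auto
  qed
  finally show ?thesis .
qed

lemma disk_Lp_integral_finite_mono:
  fixes g :: "complex \<Rightarrow> 'b::real_normed_vector" and h :: "complex \<Rightarrow> 'c::real_normed_vector"
  assumes p: "0 < p" and g: "continuous_on unit_disk g" and c: "0 \<le> c"
    and fin: "disk_Lp_integral p \<alpha> g < \<infinity>"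
    and le: "\<And>z. z \<in> unit_disk \<Longrightarrow>
      norm (h z) powr p * (1 - cmod z) powr \<beta> \<le> c * (norm (g z) powr p * (1 - cmod z) powr \<alpha>)"
  shows "disk_Lp_integral p \<beta> h < \<infinity>"
  unfolding disk_Lp_integral_def
proof (rule nn_integral_finite_if_le_cmult)
  show "(\<integral>\<^sup>+z. ennreal (norm (g z) powr p * (1 - cmod z) powr \<alpha>) * indicator unit_disk z \<partial>lborel) < \<infinity>"
    using fin by (simp add: disk_Lp_integral_def)
  show "(\<lambda>z. ennreal (norm (g z) powr p * (1 - cmod z) powr \<alpha>) * indicator unit_disk z)
      \<in> borel_measurable lborel"
    using borel_measurable_on_disk[OF continuous_on_disk_weight[OF p g]] by simp
  fix z
  show "ennreal (norm (h z) powr p * (1 - cmod z) powr \<beta>) * indicator unit_disk z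
     \<le> ennreal c * (ennreal (norm (g z) powr p * (1 - cmod z) powr \<alpha>) * indicator unit_disk z)"
    using le[of z] c by (auto simp: indicator_def ennreal_mult'[symmetric] ennreal_leI)
qed

section \<open>Local estimates for holomorphic functions\<close>

text \<open>Cauchy's inequality on discs of radius \<open>R/4\<close> bounds the derivative by \<open>4 B / R\<close> on the closed disc
of half the radius.\<close>

lemma holomorphic_lipschitz_half_ball:
  assumes hol: "f holomorphic_on ball z R" and R: "0 < R"
    and bd: "\<And>w. w \<in> ball z R \<Longrightarrow> cmod (f w) \<le> B"
    and w: "cmod (w - z) \<le> R / 2"
  shows "cmod (f w - f z) \<le> 4 * B / R * cmod (w - z)"
proof (rule field_differentiable_bound[where S = "cball z (R/2)" and f' = "deriv f"])
  show "convex (cball z (R/2))" by simp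
  show "w \<in> cball z (R/2)" using w by (simp add: dist_norm norm_minus_commute)
  show "z \<in> cball z (R/2)" using R by simp
  fix u assume u: "u \<in> cball z (R/2)"
  have uR: "u \<in> ball z R" using u R by auto
  show "(f has_field_derivative deriv f u) (at u within cball z (R / 2))"
    using holomorphic_derivI[OF hol open_ball uR] by (rule has_field_derivative_at_within)
  have sub: "cball u (R/4) \<subseteq> ball z R"
  proof
    fix v assume v: "v \<in> cball u (R/4)"
    have "dist z v \<le> dist z u + dist u v" by (rule dist_triangle)
    then show "v \<in> ball z R" using u v R by simp
  qed
  have "cmod ((deriv ^^ 1) f u) \<le> fact 1 * B / (R/4) ^ 1"
  proof (rule Cauchy_inequality)
    show "f holomorphic_on ball u (R/4)"
      using hol sub by (meson ball_subset_cball holomorphic_on_subset)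
    show "continuous_on (cball u (R/4)) f"
      using hol sub holomorphic_on_imp_continuous_on holomorphic_on_subset by blast
    show "0 < R/4" using R by simp
    fix x assume "cmod (u - x) = R/4"
    then have "x \<in> cball u (R/4)" by (simp add: dist_norm)
    then show "cmod (f x) \<le> B" using sub bd by blast
  qed
  then show "norm (deriv f u) \<le> 4 * B / R" by (simp add: field_simps)
qed

text \<open>A substitute for the subharmonicity of \<open>|f|\<^sup>p\<close> that needs neither circular means nor the case
distinction \<open>p \<ge> 1\<close>. Let \<open>z\<close> maximise \<open>dist(w)\<^sup>2 |f(w)|\<^sup>p\<close> over a disc, where \<open>dist(w)\<close> is the distance
of \<open>w\<close> to its boundary, and let \<open>d = dist(z)\<close>. By maximality \<open>|f| \<le> 4\<^bsup>1/p\<^esup> |f(z)|\<close> at distance less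
than \<open>d/2\<close> from \<open>z\<close>, so the Lipschitz bound keeps \<open>|f| \<ge> |f(z)| / 2\<close> on a disc of radius comparable
to \<open>d\<close>. Integrating there gives a multiple of \<open>d\<^sup>2 |f(z)|\<^sup>p\<close>, which dominates the value of the
maximised function at the centre of the disc.\<close>

lemma holomorphic_power_area_bound:
  fixes p :: real
  assumes p: "0 < p"
  obtains k where "0 < k"
    "\<And>f z R. \<lbrakk>f holomorphic_on ball z R; 0 < R\<rbrakk> \<Longrightarrow>
       ennreal (k * R\<^sup>2 * cmod (f z) powr p)
         \<le> (\<integral>\<^sup>+w. ennreal (cmod (f w) powr p) * indicator (ball z R) w \<partial>lborel)"
proof -
  define L :: real where "L = 4 powr (1/p)"
  \<comment> \<open>makes the Lipschitz bound \<open>8 L |f(z)| / d\<close> move \<open>f\<close> by at most \<open>|f(z)| / 2\<close> within distance \<open>c d\<close>\<close>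
  define c where "c = 1 / (16 * L)"
  define k where "k = pi * c\<^sup>2 * (1/2) powr p / 4"
  have L: "1 \<le> L" unfolding L_def using p by (simp add: ge_one_powr_ge_zero)
  have Lp: "L powr p = 4" unfolding L_def using p by (simp add: powr_powr)
  have c: "0 < c" "c \<le> 1/4" using L by (auto simp: c_def field_simps)
  have k: "0 < k" unfolding k_def using c by simp
  have main: "ennreal (k * R\<^sup>2 * cmod (f a) powr p)
         \<le> (\<integral>\<^sup>+w. ennreal (cmod (f w) powr p) * indicator (ball a R) w \<partial>lborel)"
    if hol: "f holomorphic_on ball a R" and R: "0 < R" for f a R
  proof -
    \<comment> \<open>half the radius, because \<open>f\<close> need not extend continuously to the closed disc of radius \<open>R\<close>\<close>
    define h where "h = (\<lambda>w. (R/2 - dist w a)\<^sup>2 * cmod (f w) powr p)"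
    have subR: "cball a (R/2) \<subseteq> ball a R" using R by auto
    have "continuous_on (cball a (R/2)) f"
      using hol subR holomorphic_on_imp_continuous_on holomorphic_on_subset by blast
    then have "continuous_on (cball a (R/2)) h"
      unfolding h_def using p by (intro continuous_intros continuous_on_powr') auto
    then obtain z where z: "z \<in> cball a (R/2)"
      and zmax: "\<And>w. w \<in> cball a (R/2) \<Longrightarrow> h w \<le> h z"
      using continuous_attains_sup[of "cball a (R/2)" h] R by auto
    define d where "d = R/2 - dist z a"
    have d0: "0 \<le> d" using z by (simp add: d_def dist_commute)
    have "h a \<le> h z" using zmax[of a] R by simp
    then have ha: "(R/2)\<^sup>2 * cmod (f a) powr p \<le> d\<^sup>2 * cmod (f z) powr p"
      by (simp add: h_def d_def)
    show ?thesis
    proof (cases "d = 0 \<or> f z = 0")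
      case True
      then have "(R/2)\<^sup>2 * cmod (f a) powr p \<le> 0" using ha by auto
      then have "cmod (f a) powr p \<le> 0" using R by (simp add: mult_le_0_iff)
      then have "cmod (f a) powr p = 0" by simp
      then show ?thesis by simp
    next
      case False
      then have d: "0 < d" and fz: "0 < cmod (f z)" using d0 by auto
      have near: "w \<in> cball a (R/2) \<and> d/2 \<le> R/2 - dist w a" if "w \<in> ball z (d/2)" for w
      proof -
        have "dist w a \<le> dist z w + dist z a"
          by (metis dist_commute dist_triangle)
        then show ?thesis using that d unfolding d_def by (auto simp: dist_commute)
      qed
      have bd: "cmod (f w) \<le> L * cmod (f z)" if w: "w \<in> ball z (d/2)" for w
      proof -
        have "(d/2)\<^sup>2 * cmod (f w) powr p \<le> h w"
          unfolding h_def using near[OF w] d by (intro mult_right_mono power_mono) auto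
        also have "\<dots> \<le> h z" using zmax near[OF w] by blast
        also have "h z = d\<^sup>2 * cmod (f z) powr p" by (simp add: h_def d_def)
        finally have "cmod (f w) powr p \<le> 4 * cmod (f z) powr p"
          using d by (simp add: power2_eq_square field_simps)
        also have "\<dots> = (L * cmod (f z)) powr p" using L by (simp add: powr_mult Lp)
        finally show ?thesis
          using p L by (metis norm_ge_zero mult_nonneg_nonneg not_le powr_less_mono2 order_trans zero_le_one)
      qed
      have low: "cmod (f z) / 2 \<le> cmod (f w)" if w: "w \<in> ball z (c * d)" for w
      proof -
        have cd: "c * d \<le> d / 4" using c d by (simp add: field_simps)
        have wd: "cmod (w - z) < c * d"
          using w by (simp add: dist_norm norm_minus_commute)
        then have wd2: "cmod (w - z) \<le> d / 2 / 2" using cd by simp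
        have "cmod (f w - f z) \<le> 4 * (L * cmod (f z)) / (d/2) * cmod (w - z)"
        proof (rule holomorphic_lipschitz_half_ball[OF _ _ bd])
          show "f holomorphic_on ball z (d/2)"
            using hol near subR by (meson holomorphic_on_subset subset_iff)
        qed (use d wd2 in auto)
        also have "\<dots> \<le> 4 * (L * cmod (f z)) / (d/2) * (c * d)"
          using wd d L by (intro mult_left_mono) auto
        also have "\<dots> = cmod (f z) / 2" using d L by (simp add: c_def field_simps)
        finally have "cmod (f w - f z) \<le> cmod (f z) / 2" .
        moreover have "cmod (f z) \<le> cmod (f w) + cmod (f w - f z)"
          by (metis add.commute norm_minus_commute norm_triangle_sub)
        ultimately show ?thesis by linarith
      qed
      have "k * R\<^sup>2 * cmod (f a) powr p = pi * c\<^sup>2 * (1/2) powr p * ((R/2)\<^sup>2 * cmod (f a) powr p)"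
        by (simp add: k_def power_divide)
      also have "\<dots> \<le> pi * c\<^sup>2 * (1/2) powr p * (d\<^sup>2 * cmod (f z) powr p)"
        using ha by (intro mult_left_mono) auto
      also have "\<dots> = (cmod (f z) / 2) powr p * (pi * (c * d)\<^sup>2)"
        by (simp add: powr_divide power_mult_distrib field_simps)
      finally have "ennreal (k * R\<^sup>2 * cmod (f a) powr p)
          \<le> ennreal ((cmod (f z) / 2) powr p) * emeasure lborel (ball z (c * d))"
        using c d by (subst emeasure_ball) (auto simp: unit_ball_vol_2 simp flip: ennreal_mult intro!: ennreal_leI)
      also have "\<dots> = (\<integral>\<^sup>+w. ennreal ((cmod (f z) / 2) powr p) * indicator (ball z (c * d)) w \<partial>lborel)"
        by (simp add: nn_integral_cmult_indicator)
      also have "\<dots> \<le> (\<integral>\<^sup>+w. ennreal (cmod (f w) powr p) * indicator (ball a R) w \<partial>lborel)"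
      proof (rule nn_integral_mono)
        fix w
        show "ennreal ((cmod (f z) / 2) powr p) * indicator (ball z (c * d)) w
          \<le> ennreal (cmod (f w) powr p) * indicator (ball a R) w"
        proof (cases "w \<in> ball z (c * d)")
          case True
          have "c * d \<le> d / 2" using c d by (simp add: field_simps)
          then have "w \<in> ball a R" using True near[of w] subR by auto
          then show ?thesis using True low[OF True] p
            by (auto intro!: ennreal_leI powr_mono2)
        qed auto
      qed
      finally show ?thesis .
    qed
  qed
  show ?thesis using that[OF k main] .
qed

section \<open>The local supremum of a function in the Bergman space\<close>

text \<open>Compactness makes the continuity in the first variable uniform in the second one, and a supremum
moves by no more than the functions under it.\<close>

lemma continuous_on_Sup_compact:
  fixes F :: "'a::topological_space \<Rightarrow> 'b::topological_space \<Rightarrow> real"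
  assumes cont: "continuous_on (S \<times> K) (\<lambda>x. F (fst x) (snd x))" and K: "compact K" "K \<noteq> {}"
  shows "continuous_on S (\<lambda>x. SUP y\<in>K. F x y)"
  unfolding continuous_on_topological
proof (intro ballI allI impI)
  fix x0 B assume x0: "x0 \<in> S" and B: "open B" "(SUP y\<in>K. F x0 y) \<in> B"
  obtain e where e: "0 < e" "\<And>t. dist t (SUP y\<in>K. F x0 y) < e \<Longrightarrow> t \<in> B"
    using B by (metis open_dist)
  obtain X where X: "x0 \<in> X" "open X"
    and Xe: "\<forall>x\<in>X \<inter> S. \<forall>y\<in>K. dist (F (fst (x, y)) (snd (x, y))) (F (fst (x0, y)) (snd (x0, y))) \<le> e/2"
    by (rule continuous_on_prod_compactE[OF cont K(1) x0, of "e/2"]) (use e in auto)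
  have bdd: "bdd_above (F x ` K)" if "x \<in> S" for x
  proof -
    have "continuous_on K (\<lambda>y. (x, y))" by (intro continuous_intros)
    then have "continuous_on K (\<lambda>y. F (fst (x, y)) (snd (x, y)))"
      by (rule continuous_on_compose2[OF cont]) (use that in auto)
    then have "compact (F x ` K)" using K(1) compact_continuous_image by simp
    then show ?thesis by (simp add: bounded_imp_bdd_above compact_imp_bounded)
  qed
  have "\<bar>(SUP y\<in>K. F x y) - (SUP y\<in>K. F x0 y)\<bar> \<le> e/2" if x: "x \<in> S" "x \<in> X" for x
  proof -
    have d: "\<bar>F x y - F x0 y\<bar> \<le> e/2" if "y \<in> K" for y
      using Xe x that by (auto simp: dist_real_def)
    have "(SUP y\<in>K. F x y) \<le> (SUP y\<in>K. F x0 y) + e/2"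
    proof (rule cSUP_least[OF K(2)])
      fix y assume y: "y \<in> K"
      show "F x y \<le> (SUP y\<in>K. F x0 y) + e/2"
        using d[OF y] cSUP_upper[OF y bdd[OF x0]] by linarith
    qed
    moreover have "(SUP y\<in>K. F x0 y) \<le> (SUP y\<in>K. F x y) + e/2"
    proof (rule cSUP_least[OF K(2)])
      fix y assume y: "y \<in> K"
      show "F x0 y \<le> (SUP y\<in>K. F x y) + e/2"
        using d[OF y] cSUP_upper[OF y bdd[OF x(1)]] by linarith
    qed
    ultimately show ?thesis by linarith
  qed
  then have "\<forall>x\<in>S. x \<in> X \<longrightarrow> (SUP y\<in>K. F x y) \<in> B"
    using e by (force simp: dist_real_def)
  then show "\<exists>A. open A \<and> x0 \<in> A \<and> (\<forall>y\<in>S. y \<in> A \<longrightarrow> (SUP z\<in>K. F y z) \<in> B)"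
    using X by blast
qed

text \<open>The supremum of \<open>|f|\<close> over the closed disc around \<open>z\<close> of radius \<open>(1 - |z|) / 2\<close>, parametrised by the
fixed compact set \<open>cball 0 1\<close> so that its continuity in \<open>z\<close> is that of a supremum over parameters.\<close>

definition local_sup :: "(complex \<Rightarrow> complex) \<Rightarrow> complex \<Rightarrow> real" where
  "local_sup f z = (SUP \<zeta>\<in>cball 0 1. cmod (f (z + complex_of_real ((1 - cmod z) / 2) * \<zeta>)))"

lemma local_sup_point_in_disk:
  assumes "z \<in> unit_disk" "\<zeta> \<in> cball 0 1"
  shows "z + complex_of_real ((1 - cmod z) / 2) * \<zeta> \<in> cball z ((1 - cmod z) / 2)"
    and "z + complex_of_real ((1 - cmod z) / 2) * \<zeta> \<in> unit_disk"
proof -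
  have "(1 - cmod z) / 2 * cmod \<zeta> \<le> (1 - cmod z) / 2 * 1"
    using assms by (intro mult_left_mono) auto
  then have n: "cmod (complex_of_real ((1 - cmod z) / 2) * \<zeta>) \<le> (1 - cmod z) / 2"
    using assms(1) by (simp add: norm_mult del: of_real_divide of_real_diff)
  then show "z + complex_of_real ((1 - cmod z) / 2) * \<zeta> \<in> cball z ((1 - cmod z) / 2)"
    by (simp add: dist_norm del: of_real_divide of_real_diff)
  have "cmod (z + complex_of_real ((1 - cmod z) / 2) * \<zeta>)
      \<le> cmod z + cmod (complex_of_real ((1 - cmod z) / 2) * \<zeta>)"
    by (rule norm_triangle_ineq)
  also have "\<dots> \<le> cmod z + (1 - cmod z) / 2" using n by simp
  also have "\<dots> < 1" using assms(1) by (simp add: field_simps)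
  finally show "z + complex_of_real ((1 - cmod z) / 2) * \<zeta> \<in> unit_disk" by simp
qed

lemma continuous_on_local_sup:
  assumes "continuous_on unit_disk f"
  shows "continuous_on unit_disk (local_sup f)"
  unfolding local_sup_def
proof (rule continuous_on_Sup_compact)
  have "continuous_on (unit_disk \<times> cball 0 1)
      (\<lambda>x. fst x + complex_of_real ((1 - cmod (fst x)) / 2) * snd x)"
    by (intro continuous_intros) auto
  then show "continuous_on (unit_disk \<times> cball 0 1)
      (\<lambda>x. cmod (f (fst x + complex_of_real ((1 - cmod (fst x)) / 2) * snd x)))"
    by (intro continuous_on_norm continuous_on_compose2[OF assms])
       (use local_sup_point_in_disk(2) in auto)
qed auto

lemma local_sup_attained:
  assumes f: "continuous_on unit_disk f" and z: "z \<in> unit_disk"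
  obtains w where "w \<in> cball z ((1 - cmod z) / 2)" "w \<in> unit_disk" "local_sup f z = cmod (f w)"
    and "\<And>v. v \<in> cball z ((1 - cmod z) / 2) \<Longrightarrow> cmod (f v) \<le> local_sup f z"
proof -
  let ?m = "\<lambda>\<zeta>. z + complex_of_real ((1 - cmod z) / 2) * \<zeta>"
  let ?h = "\<lambda>\<zeta>. cmod (f (?m \<zeta>))"
  have cont: "continuous_on (cball 0 1) ?h"
    using local_sup_point_in_disk(2)[OF z]
    by (intro continuous_on_norm continuous_on_compose2[OF f] continuous_intros) auto
  obtain \<zeta> where \<zeta>: "\<zeta> \<in> cball 0 1" "\<And>y. y \<in> cball 0 1 \<Longrightarrow> ?h y \<le> ?h \<zeta>"
    using continuous_attains_sup[OF _ _ cont] by auto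
  have eq: "local_sup f z = ?h \<zeta>"
    unfolding local_sup_def using \<zeta> by (intro cSup_eq_maximum) auto
  have up: "cmod (f v) \<le> local_sup f z" if v: "v \<in> cball z ((1 - cmod z) / 2)" for v
  proof -
    have pos: "0 < (1 - cmod z) / 2" using z by simp
    define y where "y = (v - z) / complex_of_real ((1 - cmod z) / 2)"
    have "cmod y \<le> 1" using v pos
      by (simp add: y_def norm_divide dist_norm norm_minus_commute field_simps
          del: of_real_divide of_real_diff)
    moreover have "?m y = v" using pos unfolding y_def by (simp del: of_real_divide of_real_diff)
    ultimately show ?thesis using \<zeta>(2)[of y] eq by simp
  qed
  show ?thesis
    using that[OF local_sup_point_in_disk[OF z \<zeta>(1)] eq up] .
qed

text \<open>The supremum near \<open>z\<close> is attained at some \<open>w\<close>, and the area bound on a disc around \<open>w\<close> dominates its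
\<open>p\<close>-th power by the mean of \<open>|f|\<^sup>p\<close> over a disc around \<open>z\<close> of radius comparable to \<open>1 - |z|\<close>. For
points \<open>v\<close> of that disc \<open>1 - |v|\<close> is comparable to \<open>1 - |z|\<close>, so after exchanging the integrals the
inner one extends over at most the disc around \<open>v\<close> of radius \<open>3 (1 - |v|)\<close>, whose area cancels the
normalisation of the mean.\<close>

lemma local_sup_in_Lp:
  fixes p \<alpha> :: real
  assumes p: "0 < p" and hol: "f holomorphic_on unit_disk"
    and fin: "disk_Lp_integral p \<alpha> f < \<infinity>"
  shows "disk_Lp_integral p \<alpha> (local_sup f) < \<infinity>"
proof -
  have f: "continuous_on unit_disk f" by (rule holomorphic_on_imp_continuous_on[OF hol])
  obtain k where k: "0 < k" and kb: "\<And>f z R. \<lbrakk>f holomorphic_on ball z R; 0 < R\<rbrakk> \<Longrightarrow>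
       ennreal (k * R\<^sup>2 * cmod (f z) powr p)
         \<le> (\<integral>\<^sup>+w. ennreal (cmod (f w) powr p) * indicator (ball z R) w \<partial>lborel)"
    using holomorphic_power_area_bound[OF p] by blast
  define C where "C = 16 / k * 4 powr \<bar>\<alpha> - 2\<bar>"
  have C: "0 < C" using k by (simp add: C_def)
  define h where "h = (\<lambda>v. ennreal (cmod (f v) powr p * (1 - cmod v) powr (\<alpha> - 2)) * indicator unit_disk v)"
  define h' where "h' = (\<lambda>v. ennreal (cmod (f v) powr p * (1 - cmod v) powr \<alpha>) * indicator unit_disk v)"
  have h_meas [measurable]: "h \<in> borel_measurable borel"
    unfolding h_def using borel_measurable_on_disk[OF continuous_on_disk_weight[OF p f]] .
  have h'_meas [measurable]: "h' \<in> borel_measurable borel"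
    unfolding h'_def using borel_measurable_on_disk[OF continuous_on_disk_weight[OF p f]] .
  \<comment> \<open>the kernel of the double integral; it depends on \<open>z\<close> only through the condition that \<open>z\<close> is near \<open>v\<close>\<close>
  define H where "H = (\<lambda>z v. if dist v z < 3 * (1 - cmod v) then ennreal C * h v else 0)"
  have H_meas: "(\<lambda>(z, v). H z v) \<in> borel_measurable (lborel \<Otimes>\<^sub>M lborel)"
    unfolding H_def by measurable
  have pointwise: "ennreal (norm (local_sup f z) powr p * (1 - cmod z) powr \<alpha>) * indicator unit_disk z
      \<le> (\<integral>\<^sup>+v. H z v \<partial>lborel)" for z
  proof (cases "z \<in> unit_disk")
    case True
    define s where "s = 1 - cmod z"
    have s: "0 < s" using True by (simp add: s_def)
    obtain w where w: "w \<in> cball z (s / 2)" "w \<in> unit_disk" "local_sup f z = cmod (f w)"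
      using local_sup_attained[OF f True] unfolding s_def by metis
    have ball: "dist v z < 3/4 * s" if "v \<in> ball w (s/4)" for v
      using that w(1) dist_triangle[of v z w] by (simp add: dist_commute)
    have comp: "s \<le> 4 * (1 - cmod v)" "1 - cmod v \<le> 4 * s" "0 < 1 - cmod v" "dist v z < 3 * (1 - cmod v)"
      if "dist v z < 3/4 * s" for v
    proof -
      have "cmod v \<le> cmod z + dist v z" "cmod z \<le> cmod v + dist v z"
        by (metis dist_commute dist_norm norm_triangle_sub)+
      then show "s \<le> 4 * (1 - cmod v)" "1 - cmod v \<le> 4 * s" "0 < 1 - cmod v" "dist v z < 3 * (1 - cmod v)"
        using that s unfolding s_def by simp_all
    qed
    have "ball w (s/4) \<subseteq> unit_disk" using ball comp(3) by fastforce
    then have "f holomorphic_on ball w (s/4)" using hol holomorphic_on_subset by blast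
    then have "ennreal (k * (s/4)\<^sup>2 * cmod (f w) powr p)
         \<le> (\<integral>\<^sup>+v. ennreal (cmod (f v) powr p) * indicator (ball w (s/4)) v \<partial>lborel)"
      using kb[of f w "s/4"] s by simp
    then have "ennreal (16 / k * s powr (\<alpha> - 2)) * ennreal (k * (s/4)\<^sup>2 * cmod (f w) powr p)
         \<le> ennreal (16 / k * s powr (\<alpha> - 2)) *
            (\<integral>\<^sup>+v. ennreal (cmod (f v) powr p) * indicator (ball w (s/4)) v \<partial>lborel)"
      by (rule mult_left_mono) simp
    also have "ennreal (16 / k * s powr (\<alpha> - 2)) * ennreal (k * (s/4)\<^sup>2 * cmod (f w) powr p)
        = ennreal (cmod (f w) powr p * s powr \<alpha>)"
    proof -
      have "s powr \<alpha> = s powr (\<alpha> - 2) * s\<^sup>2"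
        using s by (simp add: powr_diff powr_numeral)
      then show ?thesis using k by (simp add: power_divide field_simps flip: ennreal_mult)
    qed
    also have "ennreal (16 / k * s powr (\<alpha> - 2)) *
          (\<integral>\<^sup>+v. ennreal (cmod (f v) powr p) * indicator (ball w (s/4)) v \<partial>lborel)
        = (\<integral>\<^sup>+v. ennreal (16 / k * s powr (\<alpha> - 2)) *
            (ennreal (cmod (f v) powr p) * indicator (ball w (s/4)) v) \<partial>lborel)"
    proof (rule nn_integral_cmult[symmetric])
      have [measurable]: "ball w (s/4) \<in> sets borel" by simp
      have "(\<lambda>v. ennreal (cmod (f v) powr p * (1 - cmod v) powr 0) * indicator unit_disk v
              * indicator (ball w (s/4)) v) \<in> borel_measurable borel"
        using borel_measurable_on_disk[OF continuous_on_disk_weight[OF p f]] by measurable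
      moreover have "ennreal (cmod (f v) powr p * (1 - cmod v) powr 0) * indicator unit_disk v
              * indicator (ball w (s/4)) v = ennreal (cmod (f v) powr p) * indicator (ball w (s/4)) v" for v
        using \<open>ball w (s/4) \<subseteq> unit_disk\<close> by (force simp: indicator_def)
      ultimately show "(\<lambda>v. ennreal (cmod (f v) powr p) * indicator (ball w (s/4)) v) \<in> borel_measurable lborel"
        by simp
    qed
    also have "\<dots> \<le> (\<integral>\<^sup>+v. H z v \<partial>lborel)"
    proof (rule nn_integral_mono)
      fix v
      show "ennreal (16 / k * s powr (\<alpha> - 2)) * (ennreal (cmod (f v) powr p) * indicator (ball w (s/4)) v) \<le> H z v"
      proof (cases "v \<in> ball w (s/4)")
        case True
        note cv = comp[OF ball[OF True]]
        have "s powr (\<alpha> - 2) \<le> 4 powr \<bar>\<alpha> - 2\<bar> * (1 - cmod v) powr (\<alpha> - 2)"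
          using s cv by (intro powr_between) auto
        then have "16 / k * s powr (\<alpha> - 2) * cmod (f v) powr p
            \<le> 16 / k * (4 powr \<bar>\<alpha> - 2\<bar> * (1 - cmod v) powr (\<alpha> - 2)) * cmod (f v) powr p"
          using k by (intro mult_right_mono mult_left_mono) auto
        also have "\<dots> = C * (cmod (f v) powr p * (1 - cmod v) powr (\<alpha> - 2))" by (simp add: C_def)
        finally show ?thesis using True cv C k
          by (simp add: H_def h_def ennreal_leI flip: ennreal_mult)
      qed simp
    qed
    finally show ?thesis using True w(3) by (simp add: s_def)
  qed simp
  have inner: "(\<integral>\<^sup>+z. H z v \<partial>lborel) = ennreal (C * 9 * pi) * h' v" for v
  proof (cases "v \<in> unit_disk")
    case True
    define t where "t = 1 - cmod v"
    have t: "0 < t" using True by (simp add: t_def)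
    have "(\<integral>\<^sup>+z. H z v \<partial>lborel) = (\<integral>\<^sup>+z. ennreal C * h v * indicator (ball v (3 * t)) z \<partial>lborel)"
      by (intro nn_integral_cong) (auto simp: H_def t_def)
    also have "\<dots> = ennreal C * h v * emeasure lborel (ball v (3 * t))"
      by (simp add: nn_integral_cmult_indicator)
    also have "emeasure lborel (ball v (3 * t)) = ennreal (9 * pi * t\<^sup>2)"
      using t by (subst emeasure_ball) (auto simp: unit_ball_vol_2 power_mult_distrib)
    also have "ennreal C * h v * ennreal (9 * pi * t\<^sup>2) = ennreal (C * 9 * pi) * h' v"
    proof -
      have "t powr \<alpha> = t powr (\<alpha> - 2) * t\<^sup>2"
        using t by (simp add: powr_diff powr_numeral)
      then show ?thesis using True C t
        by (simp add: h_def h'_def field_simps flip: t_def ennreal_mult)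
    qed
    finally show ?thesis .
  next
    case False
    then have "H z v = 0" for z by (simp add: H_def h_def)
    then show ?thesis using False by (simp add: h'_def)
  qed
  have "disk_Lp_integral p \<alpha> (local_sup f) \<le> (\<integral>\<^sup>+z. \<integral>\<^sup>+v. H z v \<partial>lborel \<partial>lborel)"
    unfolding disk_Lp_integral_def by (intro nn_integral_mono pointwise)
  also have "\<dots> = (\<integral>\<^sup>+v. \<integral>\<^sup>+z. H z v \<partial>lborel \<partial>lborel)"
    using lborel_pair.Fubini'[OF H_meas] by simp
  also have "\<dots> = ennreal (C * 9 * pi) * disk_Lp_integral p \<alpha> f"
    unfolding inner disk_Lp_integral_def h'_def[symmetric] by (rule nn_integral_cmult) simp
  also have "\<dots> < \<infinity>" using fin by (simp add: ennreal_mult_less_top)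
  finally show ?thesis .
qed

section \<open>Integration along rays\<close>

lemma nn_integral_dilation_complex:
  assumes h: "h \<in> borel_measurable borel" and s: "0 < s"
  shows "(\<integral>\<^sup>+z. h (z::complex) \<partial>lborel) = (\<integral>\<^sup>+u. ennreal (s\<^sup>2) * h (s *\<^sub>R u) \<partial>lborel)"
proof -
  have [measurable]: "(\<lambda>x::complex. 0 + s *\<^sub>R x) \<in> borel_measurable lborel" by measurable
  have "(\<integral>\<^sup>+z. h (z::complex) \<partial>lborel)
      = (\<integral>\<^sup>+z. h z \<partial>density (distr lborel borel (\<lambda>x. 0 + s *\<^sub>R x)) (\<lambda>x. ennreal (\<bar>s\<bar> ^ DIM(complex))))"
    using lborel_affine[of s "0::complex"] s by simp
  also have "\<dots> = (\<integral>\<^sup>+z. ennreal (\<bar>s\<bar> ^ DIM(complex)) * h z \<partial>distr lborel borel (\<lambda>x. 0 + s *\<^sub>R x))"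
    using h by (intro nn_integral_density) auto
  also have "\<dots> = (\<integral>\<^sup>+u. ennreal (s\<^sup>2) * h (s *\<^sub>R u) \<partial>lborel)"
    using h s by (subst nn_integral_distr) auto
  finally show ?thesis .
qed

text \<open>Polar coordinates in which an annulus of directions replaces the circle, so that dilations and
Tonelli's theorem suffice. Every \<open>z \<noteq> 0\<close> satisfies
\<open>1 = \<integral> (2 / |z|) ds\<close> over \<open>|z| / 2 \<le> s \<le> |z|\<close>; inserting this factor, exchanging the integrals and
substituting \<open>z = s u\<close> turns the condition on \<open>s\<close> into \<open>1 \<le> |u| \<le> 2\<close>.\<close>

lemma nn_integral_complex_radial:
  fixes F :: "complex \<Rightarrow> ennreal"
  assumes F [measurable]: "F \<in> borel_measurable borel"
  shows "(\<integral>\<^sup>+z. F z \<partial>lborel) =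
    (\<integral>\<^sup>+u. ennreal (2 / cmod u ^ 3) * (\<integral>\<^sup>+r. ennreal r * F (r *\<^sub>R sgn u) * indicator {0<..} r \<partial>lborel)
        * indicator {u. 1 \<le> cmod u \<and> cmod u \<le> 2} u \<partial>lborel)"
proof -
  \<comment> \<open>the integrand in the variables \<open>z\<close>, \<open>s\<close> and, as \<open>V\<close>, in the variables \<open>u = z / s\<close>, \<open>s\<close>\<close>
  define W where "W = (\<lambda>z s. if 0 < s \<and> cmod z / 2 \<le> s \<and> s \<le> cmod z then F z * ennreal (2 / cmod z) else 0)"
  define V where "V = (\<lambda>u s. if 0 < s \<and> 1 \<le> cmod u \<and> cmod u \<le> 2
      then ennreal (2 / cmod u) * (ennreal s * F (s *\<^sub>R u)) else 0)"
  have W_meas: "(\<lambda>(z, s). W z s) \<in> borel_measurable (lborel \<Otimes>\<^sub>M lborel)"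
    unfolding W_def by measurable
  have V_meas: "(\<lambda>(u, s). V u s) \<in> borel_measurable (lborel \<Otimes>\<^sub>M lborel)"
    unfolding V_def by measurable
  have W_inner: "(\<integral>\<^sup>+s. W z s \<partial>lborel) = F z" if z: "z \<noteq> 0" for z
  proof -
    have pos: "0 < s" if "cmod z \<le> s * 2" for s
      using z that by (smt (verit) zero_less_norm_iff)
    have "(\<integral>\<^sup>+s. W z s \<partial>lborel)
        = (\<integral>\<^sup>+s. F z * ennreal (2 / cmod z) * indicator {cmod z / 2..cmod z} s \<partial>lborel)"
      using z by (intro nn_integral_cong) (auto simp: W_def indicator_def pos)
    also have "\<dots> = F z * (ennreal (2 / cmod z) * ennreal (cmod z / 2))"
      by (subst nn_integral_cmult_indicator) (simp_all add: mult.assoc)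
    also have "ennreal (2 / cmod z) * ennreal (cmod z / 2) = 1"
      using z by (simp flip: ennreal_mult)
    finally show ?thesis by simp
  qed
  have WV: "(\<integral>\<^sup>+z. W z s \<partial>lborel) = (\<integral>\<^sup>+u. V u s \<partial>lborel)" for s
  proof (cases "0 < s")
    case True
    have "(\<integral>\<^sup>+z. W z s \<partial>lborel) = (\<integral>\<^sup>+u. ennreal (s\<^sup>2) * W (s *\<^sub>R u) s \<partial>lborel)"
      using True by (intro nn_integral_dilation_complex) (auto simp: W_def)
    also have "\<dots> = (\<integral>\<^sup>+u. V u s \<partial>lborel)"
    proof (intro nn_integral_cong)
      fix u
      have "s * cmod u / 2 \<le> s \<longleftrightarrow> cmod u \<le> 2" "s \<le> s * cmod u \<longleftrightarrow> 1 \<le> cmod u"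
        using True by (auto simp: field_simps)
      moreover have "ennreal (s\<^sup>2) * (F (s *\<^sub>R u) * ennreal (2 / (s * cmod u)))
          = ennreal (2 / cmod u) * (ennreal s * F (s *\<^sub>R u))"
      proof -
        have "ennreal (s\<^sup>2) * (F (s *\<^sub>R u) * ennreal (2 / (s * cmod u)))
          = F (s *\<^sub>R u) * (ennreal (s\<^sup>2) * ennreal (2 / (s * cmod u)))" by (simp add: mult_ac)
        also have "ennreal (s\<^sup>2) * ennreal (2 / (s * cmod u)) = ennreal (2 / cmod u) * ennreal s"
          using True by (simp add: power2_eq_square flip: ennreal_mult)
        finally show ?thesis by (simp add: mult_ac)
      qed
      ultimately show "ennreal (s\<^sup>2) * W (s *\<^sub>R u) s = V u s"
        using True by (simp add: W_def V_def)
    qed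
    finally show ?thesis .
  qed (simp add: W_def V_def)
  have V_inner: "(\<integral>\<^sup>+s. V u s \<partial>lborel) = ennreal (2 / cmod u ^ 3) *
      (\<integral>\<^sup>+r. ennreal r * F (r *\<^sub>R sgn u) * indicator {0<..} r \<partial>lborel)
        * indicator {u. 1 \<le> cmod u \<and> cmod u \<le> 2} u" for u
  proof (cases "1 \<le> cmod u \<and> cmod u \<le> 2")
    case True
    then have u: "0 < cmod u" by linarith
    let ?g = "\<lambda>r. ennreal r * F (r *\<^sub>R sgn u) * indicator {0<..} r"
    let ?I = "\<integral>\<^sup>+s. ennreal s * F (s *\<^sub>R u) * indicator {0<..} s \<partial>lborel"
    have "(\<integral>\<^sup>+r. ?g r \<partial>lborel) = ennreal \<bar>cmod u\<bar> * (\<integral>\<^sup>+s. ?g (0 + cmod u * s) \<partial>lborel)"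
      using u by (intro nn_integral_real_affine) auto
    also have "(\<integral>\<^sup>+s. ?g (0 + cmod u * s) \<partial>lborel)
        = (\<integral>\<^sup>+s. ennreal (cmod u) * (ennreal s * F (s *\<^sub>R u) * indicator {0<..} s) \<partial>lborel)"
    proof (intro nn_integral_cong)
      fix s
      have "(cmod u * s) *\<^sub>R sgn u = s *\<^sub>R u" using u by (simp add: sgn_div_norm)
      then show "?g (0 + cmod u * s) = ennreal (cmod u) * (ennreal s * F (s *\<^sub>R u) * indicator {0<..} s)"
        using u by (auto simp: indicator_def ennreal_mult mult.assoc zero_less_mult_iff)
    qed
    also have "\<dots> = ennreal (cmod u) * ?I"
      by (rule nn_integral_cmult) measurable
    finally have g: "(\<integral>\<^sup>+r. ?g r \<partial>lborel) = ennreal ((cmod u)\<^sup>2) * ?I"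
      by (simp add: power2_eq_square ennreal_mult mult.assoc)
    have "(\<integral>\<^sup>+s. V u s \<partial>lborel)
        = (\<integral>\<^sup>+s. ennreal (2 / cmod u) * (ennreal s * F (s *\<^sub>R u) * indicator {0<..} s) \<partial>lborel)"
      using True by (intro nn_integral_cong) (auto simp: V_def indicator_def)
    also have "\<dots> = ennreal (2 / cmod u) * ?I"
      by (rule nn_integral_cmult) measurable
    also have "ennreal (2 / cmod u) = ennreal (2 / cmod u ^ 3) * ennreal ((cmod u)\<^sup>2)"
      using u by (simp add: power2_eq_square power3_eq_cube flip: ennreal_mult)
    finally show ?thesis using True g by (simp add: mult.assoc)
  qed (auto simp: V_def)
  have "(\<integral>\<^sup>+z. F z \<partial>lborel) = (\<integral>\<^sup>+z. \<integral>\<^sup>+s. W z s \<partial>lborel \<partial>lborel)"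
    using AE_lborel_singleton[of "0::complex"] by (intro nn_integral_cong_AE) (auto simp: W_inner elim: eventually_mono)
  also have "\<dots> = (\<integral>\<^sup>+s. \<integral>\<^sup>+z. W z s \<partial>lborel \<partial>lborel)"
    using lborel_pair.Fubini'[OF W_meas] by simp
  also have "\<dots> = (\<integral>\<^sup>+s. \<integral>\<^sup>+u. V u s \<partial>lborel \<partial>lborel)" by (simp add: WV)
  also have "\<dots> = (\<integral>\<^sup>+u. \<integral>\<^sup>+s. V u s \<partial>lborel \<partial>lborel)"
    using lborel_pair.Fubini'[OF V_meas] by simp
  finally show ?thesis by (simp add: V_inner)
qed

text \<open>An inequality between the integrals of two functions along every ray, with uniform constants,
passes to the plane.\<close>

lemma nn_integral_complex_finite_by_rays:
  fixes F G :: "complex \<Rightarrow> ennreal"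
  assumes [measurable]: "F \<in> borel_measurable borel" "G \<in> borel_measurable borel"
    and rays: "\<And>v. cmod v = 1 \<Longrightarrow>
      (\<integral>\<^sup>+r. ennreal r * F (r *\<^sub>R v) * indicator {0<..} r \<partial>lborel)
        \<le> ennreal K + ennreal L * (\<integral>\<^sup>+r. ennreal r * G (r *\<^sub>R v) * indicator {0<..} r \<partial>lborel)"
    and G: "(\<integral>\<^sup>+z. G z \<partial>lborel) < \<infinity>"
  shows "(\<integral>\<^sup>+z. F z \<partial>lborel) < \<infinity>"
proof -
  let ?A = "{u::complex. 1 \<le> cmod u \<and> cmod u \<le> 2}"
  let ?J = "\<lambda>H u. ennreal (2 / cmod u ^ 3) *
     (\<integral>\<^sup>+r. ennreal r * H (r *\<^sub>R sgn u) * indicator {0<..} r \<partial>lborel) * indicator ?A u"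
  have "(\<integral>\<^sup>+z. F z \<partial>lborel) = (\<integral>\<^sup>+u. ?J F u \<partial>lborel)"
    by (rule nn_integral_complex_radial) measurable
  also have "\<dots> \<le> (\<integral>\<^sup>+u. ennreal (2 * K) * indicator ?A u + ennreal L * ?J G u \<partial>lborel)"
  proof (rule nn_integral_mono)
    fix u
    show "?J F u \<le> ennreal (2 * K) * indicator ?A u + ennreal L * ?J G u"
    proof (cases "u \<in> ?A")
      case True
      then have u: "1 \<le> cmod u" "u \<noteq> 0" by auto
      let ?c = "ennreal (2 / cmod u ^ 3)"
      have "1 \<le> cmod u ^ 3" using u by (simp add: one_le_power)
      then have c: "?c \<le> ennreal 2" by (intro ennreal_leI) (simp add: divide_le_eq)
      have "?J F u = ?c * (\<integral>\<^sup>+r. ennreal r * F (r *\<^sub>R sgn u) * indicator {0<..} r \<partial>lborel)"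
        using True by simp
      also have "\<dots> \<le> ?c * (ennreal K + ennreal L * (\<integral>\<^sup>+r. ennreal r * G (r *\<^sub>R sgn u) * indicator {0<..} r \<partial>lborel))"
        using u by (intro mult_left_mono rays) (auto simp: norm_sgn)
      also have "\<dots> = ?c * ennreal K + ennreal L * ?J G u"
        using True by (simp add: distrib_left mult_ac)
      also have "\<dots> \<le> ennreal (2 * K) + ennreal L * ?J G u"
      proof -
        have "?c * ennreal K \<le> ennreal 2 * ennreal K" using c by (rule mult_right_mono) simp
        then show ?thesis by (intro add_right_mono) (simp add: ennreal_mult')
      qed
      finally show ?thesis using True by simp
    qed simp
  qed
  also have "\<dots> = ennreal (2 * K) * emeasure lborel ?A + ennreal L * (\<integral>\<^sup>+z. G z \<partial>lborel)"
  proof -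
    have A [measurable]: "?A \<in> sets lborel" by measurable
    have [measurable]: "?J G \<in> borel_measurable lborel" by measurable
    have "(\<integral>\<^sup>+u. ennreal (2 * K) * indicator ?A u + ennreal L * ?J G u \<partial>lborel)
       = (\<integral>\<^sup>+u. ennreal (2 * K) * indicator ?A u \<partial>lborel) + (\<integral>\<^sup>+u. ennreal L * ?J G u \<partial>lborel)"
      by (rule nn_integral_add) measurable
    also have "(\<integral>\<^sup>+u. ennreal L * ?J G u \<partial>lborel) = ennreal L * (\<integral>\<^sup>+u. ?J G u \<partial>lborel)"
      by (rule nn_integral_cmult) measurable
    also have "(\<integral>\<^sup>+u. ?J G u \<partial>lborel) = (\<integral>\<^sup>+z. G z \<partial>lborel)"
      by (rule nn_integral_complex_radial[symmetric]) measurable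
    also have "(\<integral>\<^sup>+u. ennreal (2 * K) * indicator ?A u \<partial>lborel) = ennreal (2 * K) * emeasure lborel ?A"
      using A by (rule nn_integral_cmult_indicator)
    finally show ?thesis .
  qed
  also have "\<dots> < \<infinity>"
  proof -
    have "emeasure lborel ?A \<le> emeasure lborel (cball (0::complex) 2)"
      by (intro emeasure_mono) auto
    also have "\<dots> < \<infinity>" by (rule emeasure_lborel_cball_finite)
    finally show ?thesis using G by (simp add: ennreal_mult_less_top)
  qed
  finally show ?thesis .
qed

section \<open>A Hardy inequality for distance-doubling steps\<close>

text \<open>The factor of \<open>x\<^sup>p\<close> can be brought as close to 1 as desired, whether \<open>p\<close> is above or below 1. This is
what keeps the contraction in the radial inequality below strict.\<close>

lemma powr_add_le_small_loss:
  fixes p \<epsilon> :: real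
  assumes p: "0 < p" and \<epsilon>: "0 < \<epsilon>"
  obtains C where "0 < C"
    "\<And>x y. \<lbrakk>0 \<le> x; 0 \<le> y\<rbrakk> \<Longrightarrow> (x + y) powr p \<le> (1 + \<epsilon>) * x powr p + C * y powr p"
proof -
  define \<delta> where "\<delta> = (1 + \<epsilon>) powr (1/p) - 1"
  have \<delta>: "0 < \<delta>" unfolding \<delta>_def using p \<epsilon> by (simp add: gr_one_powr)
  have \<delta>p: "(1 + \<delta>) powr p = 1 + \<epsilon>" unfolding \<delta>_def using p \<epsilon> by (simp add: powr_powr)
  have "(x + y) powr p \<le> (1 + \<epsilon>) * x powr p + (1 + 1/\<delta>) powr p * y powr p"
    if xy: "0 \<le> x" "0 \<le> y" for x y
  proof (cases "y \<le> \<delta> * x")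
    case True
    then have "(x + y) powr p \<le> ((1 + \<delta>) * x) powr p"
      using xy p \<delta> by (intro powr_mono2) (auto simp: algebra_simps)
    also have "\<dots> = (1 + \<epsilon>) * x powr p" using xy \<delta> by (simp add: powr_mult \<delta>p)
    finally show ?thesis by (smt (verit) mult_nonneg_nonneg powr_ge_zero)
  next
    case False
    then have "(x + y) powr p \<le> ((1 + 1/\<delta>) * y) powr p"
      using xy p \<delta> by (intro powr_mono2) (auto simp: field_simps)
    also have "\<dots> = (1 + 1/\<delta>) powr p * y powr p" using xy \<delta> by (simp add: powr_mult)
    finally show ?thesis using \<epsilon> by (smt (verit) mult_nonneg_nonneg powr_ge_zero)
  qed
  moreover have "0 < 1 + 1/\<delta>" using \<delta> by (simp add: add_pos_pos)
  then have "0 < (1 + 1/\<delta>) powr p" by simp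
  ultimately show ?thesis using that by blast
qed

text \<open>The map \<open>r \<mapsto> 2 r - 1\<close> doubles the distance to 1. The factor that it produces,
\<open>2\<close> to the power \<open>- (1 + a)\<close>, is less than 1 exactly when \<open>a > -1\<close>.\<close>

lemma weighted_tail_substitution:
  fixes h :: "real \<Rightarrow> real" and a R :: real
  assumes [measurable]: "h \<in> borel_measurable borel" and h: "\<And>r. 0 \<le> h r" and R: "R \<le> 1"
  shows "(\<integral>\<^sup>+r. ennreal (h (2 * r - 1) * (1 - r) powr a) * indicator {1/2..<R} r \<partial>lborel)
    \<le> ennreal ((1/2) powr (1 + a)) *
       (\<integral>\<^sup>+r. ennreal (h r * (1 - r) powr a) * indicator {0..<R} r \<partial>lborel)"
proof -
  have "(\<integral>\<^sup>+r. ennreal (h (2 * r - 1) * (1 - r) powr a) * indicator {1/2..<R} r \<partial>lborel)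
      = ennreal \<bar>1/2\<bar> * (\<integral>\<^sup>+u. ennreal (h (2 * (1/2 + 1/2 * u) - 1) * (1 - (1/2 + 1/2 * u)) powr a)
            * indicator {1/2..<R} (1/2 + 1/2 * u) \<partial>lborel)"
    by (rule nn_integral_real_affine) auto
  also have "\<dots> \<le> ennreal (1/2) * (\<integral>\<^sup>+u. ennreal ((1/2) powr a) *
      (ennreal (h u * (1 - u) powr a) * indicator {0..<R} u) \<partial>lborel)"
  proof (rule mult_mono[OF _ nn_integral_mono])
    fix u :: real
    show "ennreal (h (2 * (1/2 + 1/2 * u) - 1) * (1 - (1/2 + 1/2 * u)) powr a) * indicator {1/2..<R} (1/2 + 1/2 * u)
      \<le> ennreal ((1/2) powr a) * (ennreal (h u * (1 - u) powr a) * indicator {0..<R} u)"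
    proof (cases "1/2 + 1/2 * u \<in> {1/2..<R}")
      case True
      then have u: "0 \<le> u" "u < R" "u < 1" using R by auto
      have "1 - (1/2 + 1/2 * u) = 1/2 * (1 - u)" by (simp add: field_simps)
      then have "(1 - (1/2 + 1/2 * u)) powr a = (1/2) powr a * (1 - u) powr a"
        using u by (simp only: powr_mult)
      moreover have "2 * (1/2 + 1/2 * u) - 1 = u" by simp
      ultimately show ?thesis using u True h
        by (simp add: ennreal_mult[symmetric] mult_ac)
    qed simp
  qed auto
  also have "\<dots> = ennreal (1/2) * (ennreal ((1/2) powr a) *
      (\<integral>\<^sup>+u. ennreal (h u * (1 - u) powr a) * indicator {0..<R} u \<partial>lborel))"
    by (subst nn_integral_cmult) auto
  also have "\<dots> = ennreal ((1/2) powr (1 + a)) *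
      (\<integral>\<^sup>+u. ennreal (h u * (1 - u) powr a) * indicator {0..<R} u \<partial>lborel)"
  proof -
    have "(1/2) powr (1 + a) = 1/2 * (1/2) powr (a::real)" by (subst powr_add) simp
    then have "ennreal ((1/2) powr (1 + a)) = ennreal (1/2 * (1/2) powr a)" by (rule arg_cong)
    also have "\<dots> = ennreal (1/2) * ennreal ((1/2) powr a)" by (rule ennreal_mult) auto
    finally have "ennreal ((1/2) powr (1 + a)) = ennreal (1/2) * ennreal ((1/2) powr a)" .
    then show ?thesis by (simp only: mult.assoc)
  qed
  finally show ?thesis .
qed

text \<open>The situation on one ray: \<open>\<phi>\<close> stands for \<open>|f|\<close>, and \<open>\<gamma>\<close> bounds the change of \<open>f\<close> when the distance to
the boundary is doubled. Both functions are defined on the whole line to keep measurability simple.\<close>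

definition radial_control :: "(real \<Rightarrow> real) \<Rightarrow> (real \<Rightarrow> real) \<Rightarrow> real \<Rightarrow> bool" where
  "radial_control \<phi> \<gamma> M \<longleftrightarrow>
     \<phi> \<in> borel_measurable borel \<and> \<gamma> \<in> borel_measurable borel \<and>
     (\<forall>r. 0 \<le> \<phi> r) \<and> (\<forall>r. 0 \<le> \<gamma> r) \<and>
     (\<forall>R<1. \<exists>B. \<forall>r\<in>{0..R}. \<phi> r \<le> B) \<and>
     (\<forall>r\<in>{0..1/2}. \<phi> r \<le> M \<and> \<gamma> r \<le> M) \<and>
     (\<forall>r\<in>{1/2..<1}. \<phi> r \<le> \<phi> (2 * r - 1) + (\<gamma> r + \<gamma> (2 * r - 1)))"

text \<open>Let \<open>I(R)\<close> be the integral of \<open>\<phi>\<^sup>p (1 - r)\<^sup>a\<close> over \<open>0 \<le> r < R\<close>. Bounding \<open>\<phi>(r)\<close> by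
\<open>\<phi>(2 r - 1)\<close> plus values of \<open>\<gamma>\<close> on \<open>r \<ge> 1/2\<close> and substituting \<open>2 r - 1\<close> yields
\<open>I(R) \<le> C M\<^sup>p + \<theta> I(R) + C \<integral> \<gamma>\<^sup>p (1 - r)\<^sup>a dr\<close> with \<open>\<theta> < 1\<close>. For \<open>R < 1\<close> the number \<open>I(R)\<close> is finite and can be absorbed
in the left-hand side; the resulting bound is independent of \<open>R\<close>. The factor \<open>r\<close> in the statement
comes from polar coordinates; where it is small, \<open>\<gamma>\<close> is bounded by \<open>M\<close>.\<close>

lemma radial_hardy_inequality:
  fixes p a :: real
  assumes p: "0 < p" and a: "-1 < a"
  shows "\<exists>K\<ge>0. \<exists>L\<ge>0. \<forall>\<phi> \<gamma> M. radial_control \<phi> \<gamma> M \<longrightarrow>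
      (\<integral>\<^sup>+r. ennreal (r * \<phi> r powr p * (1 - r) powr a) * indicator {0<..<1} r \<partial>lborel)
        \<le> ennreal (K * M powr p) + ennreal L *
          (\<integral>\<^sup>+r. ennreal (r * \<gamma> r powr p * (1 - r) powr a) * indicator {0<..<1} r \<partial>lborel)"
proof -
  define q where "q = (1/2) powr (1 + a)"
  have q: "0 < q" "q < 1" unfolding q_def using a powr_less_mono2[of "1 + a" "1/2" 1] by auto
  \<comment> \<open>places the contraction factor \<open>(1 + \<epsilon>) q\<close> halfway between \<open>q\<close> and 1\<close>
  define \<epsilon> where "\<epsilon> = (1 - q) / (2 * q)"
  have \<epsilon>: "0 < \<epsilon>" using q by (simp add: \<epsilon>_def)
  define \<theta> where "\<theta> = (1 + \<epsilon>) * q"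
  have \<theta>_eq: "\<theta> = (1 + q) / 2" using q by (simp add: \<theta>_def \<epsilon>_def field_simps)
  have \<theta>: "0 < \<theta>" "\<theta> < 1" using q by (simp_all add: \<theta>_eq)
  obtain C where C: "0 < C"
    and Cb: "\<And>x y. \<lbrakk>0 \<le> x; 0 \<le> y\<rbrakk> \<Longrightarrow> (x + y) powr p \<le> (1 + \<epsilon>) * x powr p + C * y powr p"
    using powr_add_le_small_loss[OF p \<epsilon>] by blast
  have two: "(x + y) powr p \<le> 2 powr p * (x powr p + y powr p)" if "0 \<le> x" "0 \<le> y" for x y :: real
  proof -
    have "(x + y) powr p \<le> (2 * max x y) powr p" using that p by (intro powr_mono2) auto
    also have "\<dots> = 2 powr p * max x y powr p" using that by (simp add: powr_mult)
    also have "max x y powr p \<le> x powr p + y powr p" by (auto simp: max_def)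
    finally show ?thesis by simp
  qed
  define D where "D = C * 2 powr p"
  have D: "0 < D" using C by (simp add: D_def)
  define E where "E = 2 powr \<bar>a\<bar>"
  have E: "0 < E" by (simp add: E_def)
  show ?thesis
  proof (intro exI conjI allI impI)
    show "0 \<le> (E + 2 * D * E) / (1 - \<theta>)" "0 \<le> 4 * D / (1 - \<theta>)" using D E \<theta> by auto
    fix \<phi> \<gamma> :: "real \<Rightarrow> real" and M :: real
    assume control: "radial_control \<phi> \<gamma> M"
    have meas [measurable]: "\<phi> \<in> borel_measurable borel" "\<gamma> \<in> borel_measurable borel"
      and nonneg: "\<And>r. 0 \<le> \<phi> r" "\<And>r. 0 \<le> \<gamma> r"
      and loc: "\<And>R. R < 1 \<Longrightarrow> \<exists>B. \<forall>r\<in>{0..R}. \<phi> r \<le> B"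
      and M: "\<And>r. r \<in> {0..1/2} \<Longrightarrow> \<phi> r \<le> M \<and> \<gamma> r \<le> M"
      and step: "\<And>r. r \<in> {1/2..<1} \<Longrightarrow> \<phi> r \<le> \<phi> (2 * r - 1) + (\<gamma> r + \<gamma> (2 * r - 1))"
      using control unfolding radial_control_def by blast+
    define J where "J = (\<lambda>h A. \<integral>\<^sup>+r. ennreal (h r powr p * (1 - r) powr a) * indicator A r \<partial>lborel)"
    let ?G = "\<integral>\<^sup>+r. ennreal (r * \<gamma> r powr p * (1 - r) powr a) * indicator {0<..<1} r \<partial>lborel"
    have M0: "0 \<le> M" using M[of 0] nonneg(1)[of 0] by simp
    have J_half: "J h {0..<1/2} \<le> ennreal (E * M powr p)"
      if h: "\<And>r. 0 \<le> h r" "\<And>r. r \<in> {0..1/2} \<Longrightarrow> h r \<le> M" for h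
    proof -
      have "J h {0..<1/2} \<le> (\<integral>\<^sup>+r. ennreal (E * M powr p) * indicator {0..<1/2::real} r \<partial>lborel)"
        unfolding J_def
      proof (rule nn_integral_mono)
        fix r :: real
        show "ennreal (h r powr p * (1 - r) powr a) * indicator {0..<1/2} r
          \<le> ennreal (E * M powr p) * indicator {0..<1/2} r"
        proof (cases "r \<in> {0..<1/2}")
          case True
          have "(1 - r) powr a \<le> 2 powr \<bar>a\<bar> * 1 powr a" using True by (intro powr_between) auto
          then have "(1 - r) powr a \<le> E" by (simp add: E_def)
          moreover have "h r powr p \<le> M powr p" using True h p by (intro powr_mono2) auto
          ultimately have "h r powr p * (1 - r) powr a \<le> M powr p * E" by (intro mult_mono) auto
          then show ?thesis using True by (simp add: ennreal_leI mult.commute)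
        qed simp
      qed
      also have "\<dots> = ennreal (E * M powr p) * ennreal (1/2)" by (simp add: nn_integral_cmult_indicator)
      also have "\<dots> \<le> ennreal (E * M powr p) * 1"
        by (intro mult_left_mono) (auto simp: ennreal_le_1 simp del: ennreal_half)
      finally show ?thesis by simp
    qed
    have J_split: "J h {0..<R} = J h {0..<1/2} + J h {1/2..<R}"
      if [measurable]: "h \<in> borel_measurable borel" and "1/2 \<le> R" for h R
    proof -
      have "J h {0..<R} = (\<integral>\<^sup>+r. ennreal (h r powr p * (1 - r) powr a) * indicator {0..<1/2} r
          + ennreal (h r powr p * (1 - r) powr a) * indicator {1/2..<R} r \<partial>lborel)"
        unfolding J_def using that(2) by (intro nn_integral_cong) (auto simp: indicator_def)
      also have "\<dots> = J h {0..<1/2} + J h {1/2..<R}"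
        unfolding J_def by (rule nn_integral_add) measurable
      finally show ?thesis .
    qed
    have J\<gamma>: "J \<gamma> {0..<1} \<le> ennreal (E * M powr p) + ennreal 2 * ?G"
    proof -
      have "J \<gamma> {1/2..<1} \<le> (\<integral>\<^sup>+r. ennreal 2 * (ennreal (r * \<gamma> r powr p * (1 - r) powr a) * indicator {0<..<1} r) \<partial>lborel)"
        unfolding J_def
      proof (rule nn_integral_mono)
        fix r :: real
        show "ennreal (\<gamma> r powr p * (1 - r) powr a) * indicator {1/2..<1} r
           \<le> ennreal 2 * (ennreal (r * \<gamma> r powr p * (1 - r) powr a) * indicator {0<..<1} r)"
        proof (cases "r \<in> {1/2..<1}")
          case True
          then have "1 * (\<gamma> r powr p * (1 - r) powr a) \<le> (2 * r) * (\<gamma> r powr p * (1 - r) powr a)"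
            by (intro mult_right_mono) auto
          then show ?thesis using True
            by (simp add: mult_ac ennreal_mult'[symmetric] ennreal_leI del: ennreal_numeral)
        qed simp
      qed
      also have "\<dots> = ennreal 2 * ?G" by (rule nn_integral_cmult) measurable
      finally show ?thesis using J_half[of \<gamma>] nonneg M J_split[of \<gamma> 1] by (simp add: add_mono)
    qed
    \<comment> \<open>the bound for truncated integrals, whose finiteness makes the absorption legitimate\<close>
    have trunc: "J \<phi> {0..<R} \<le> ennreal (((E + 2 * D * E) / (1 - \<theta>)) * M powr p) + ennreal (4 * D / (1 - \<theta>)) * ?G"
      if R: "1/2 \<le> R" "R < 1" for R
    proof (cases "?G = \<infinity>")
      case True
      then show ?thesis using D \<theta> by (simp add: ennreal_mult_eq_top_iff)
    next
      case False
      have "J \<phi> {0..<R} < \<infinity>"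
      proof -
        obtain B where B: "\<forall>r\<in>{0..R}. \<phi> r \<le> B" using loc R by blast
        have "J \<phi> {0..<R} \<le> (\<integral>\<^sup>+r. ennreal (B powr p * ((1/(1-R)) powr \<bar>a\<bar>)) * indicator {0..<R} r \<partial>lborel)"
          unfolding J_def
        proof (rule nn_integral_mono)
          fix r :: real
          show "ennreal (\<phi> r powr p * (1 - r) powr a) * indicator {0..<R} r
            \<le> ennreal (B powr p * ((1/(1-R)) powr \<bar>a\<bar>)) * indicator {0..<R} r"
          proof (cases "r \<in> {0..<R}")
            case True
            have "(1 - r) powr a \<le> (1/(1-R)) powr \<bar>a\<bar> * 1 powr a"
              using True R mult_mono[of "1 - r" 1 "1 - R" 1] by (intro powr_between) (auto simp: field_simps)
            then have "\<phi> r powr p * (1 - r) powr a \<le> B powr p * ((1/(1-R)) powr \<bar>a\<bar>)"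
              using True B p nonneg by (intro mult_mono powr_mono2) auto
            then show ?thesis by (intro mult_right_mono ennreal_leI) auto
          qed simp
        qed
        also have "\<dots> < \<infinity>" using R by (simp add: nn_integral_cmult_indicator ennreal_mult_less_top)
        finally show ?thesis .
      qed
      moreover have "J \<phi> {0..<R} \<le> ennreal (E * M powr p) + (ennreal \<theta> * J \<phi> {0..<R} + ennreal (2 * D) * J \<gamma> {0..<1})"
      proof -
        let ?t = "\<lambda>h. \<integral>\<^sup>+r. ennreal (h (2 * r - 1) powr p * (1 - r) powr a) * indicator {1/2..<R} r \<partial>lborel"
        have t: "?t h \<le> ennreal q * J h {0..<R}" if "h \<in> borel_measurable borel" for h
          unfolding J_def q_def
          using weighted_tail_substitution[of "\<lambda>r. h r powr p" R a] that R by simp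
        have "J \<phi> {1/2..<R} \<le> (\<integral>\<^sup>+r.
             ennreal (1 + \<epsilon>) * (ennreal (\<phi> (2 * r - 1) powr p * (1 - r) powr a) * indicator {1/2..<R} r)
           + ennreal D * (ennreal (\<gamma> r powr p * (1 - r) powr a) * indicator {1/2..<R} r
               + ennreal (\<gamma> (2 * r - 1) powr p * (1 - r) powr a) * indicator {1/2..<R} r) \<partial>lborel)"
          unfolding J_def
        proof (rule nn_integral_mono)
          fix r :: real
          show "ennreal (\<phi> r powr p * (1 - r) powr a) * indicator {1/2..<R} r \<le>
             ennreal (1 + \<epsilon>) * (ennreal (\<phi> (2 * r - 1) powr p * (1 - r) powr a) * indicator {1/2..<R} r)
           + ennreal D * (ennreal (\<gamma> r powr p * (1 - r) powr a) * indicator {1/2..<R} r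
               + ennreal (\<gamma> (2 * r - 1) powr p * (1 - r) powr a) * indicator {1/2..<R} r)"
          proof (cases "r \<in> {1/2..<R}")
            case True
            let ?x = "\<phi> (2 * r - 1)" and ?y = "\<gamma> r" and ?z = "\<gamma> (2 * r - 1)" and ?w = "(1 - r) powr a"
            have "\<phi> r powr p \<le> (?x + (?y + ?z)) powr p"
              using step[of r] True R p nonneg by (intro powr_mono2) auto
            also have "\<dots> \<le> (1 + \<epsilon>) * ?x powr p + C * (?y + ?z) powr p"
              using nonneg by (intro Cb) auto
            also have "\<dots> \<le> (1 + \<epsilon>) * ?x powr p + C * (2 powr p * (?y powr p + ?z powr p))"
              using nonneg C by (intro add_left_mono mult_left_mono two) auto
            finally have "\<phi> r powr p * ?w \<le> ((1 + \<epsilon>) * ?x powr p + C * (2 powr p * (?y powr p + ?z powr p))) * ?w"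
              by (rule mult_right_mono) simp
            also have "\<dots> = (1 + \<epsilon>) * (?x powr p * ?w) + D * (?y powr p * ?w + ?z powr p * ?w)"
              by (simp add: D_def algebra_simps)
            finally show ?thesis using True \<epsilon> D
              by (simp add: ennreal_mult'[symmetric] ennreal_plus[symmetric] ennreal_leI del: ennreal_plus)
          qed simp
        qed
        also have "\<dots> = ennreal (1 + \<epsilon>) * ?t \<phi> + ennreal D * (J \<gamma> {1/2..<R} + ?t \<gamma>)"
          unfolding J_def by (simp add: nn_integral_add nn_integral_cmult)
        also have "\<dots> \<le> ennreal (1 + \<epsilon>) * (ennreal q * J \<phi> {0..<R}) + ennreal D * (J \<gamma> {0..<1} + J \<gamma> {0..<1})"
        proof (intro add_mono mult_left_mono)
          show "?t \<phi> \<le> ennreal q * J \<phi> {0..<R}" by (rule t) simp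
          have sub: "J \<gamma> A \<le> J \<gamma> {0..<1}" if "A \<subseteq> {0..<1}" for A
            unfolding J_def using that by (intro nn_integral_mono) (auto simp: indicator_def)
          show "J \<gamma> {1/2..<R} \<le> J \<gamma> {0..<1}" using R by (intro sub) auto
          have "?t \<gamma> \<le> ennreal q * J \<gamma> {0..<R}" by (rule t) simp
          also have "\<dots> \<le> 1 * J \<gamma> {0..<1}" using R q by (intro mult_mono sub) (auto simp: ennreal_le_1)
          finally show "?t \<gamma> \<le> J \<gamma> {0..<1}" by simp
        qed auto
        also have "\<dots> = ennreal \<theta> * J \<phi> {0..<R} + ennreal (2 * D) * J \<gamma> {0..<1}"
          using \<epsilon> q D by (simp add: \<theta>_def ennreal_mult mult.assoc distrib_left[symmetric] mult_2[symmetric])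
            (simp add: mult_ac)
        finally show ?thesis
          using J_split[of \<phi> R] J_half[of \<phi>] nonneg M R by (simp add: add_mono)
      qed
      ultimately show ?thesis
      proof -
        assume fin: "J \<phi> {0..<R} < \<infinity>"
          and le: "J \<phi> {0..<R} \<le> ennreal (E * M powr p) + (ennreal \<theta> * J \<phi> {0..<R} + ennreal (2 * D) * J \<gamma> {0..<1})"
        obtain g where g: "0 \<le> g" "?G = ennreal g" using False by (cases ?G) auto
        have J\<gamma>': "J \<gamma> {0..<1} \<le> ennreal (E * M powr p + 2 * g)"
          using J\<gamma> g E by (simp add: ennreal_mult'[symmetric] ennreal_plus[symmetric] del: ennreal_plus ennreal_numeral)
        obtain x where x: "0 \<le> x" "J \<phi> {0..<R} = ennreal x" using fin by (cases "J \<phi> {0..<R}") auto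
        have "ennreal x \<le> ennreal (E * M powr p) + (ennreal \<theta> * ennreal x + ennreal (2 * D) * ennreal (E * M powr p + 2 * g))"
          using le x J\<gamma>' by (smt (verit) add_left_mono mult_left_mono order_trans zero_le)
        also have "\<dots> = ennreal (E * M powr p + (\<theta> * x + 2 * D * (E * M powr p + 2 * g)))"
          using E \<theta> D g x by (simp add: ennreal_mult'[symmetric] ennreal_plus[symmetric] del: ennreal_plus)
        finally have "x \<le> E * M powr p + (\<theta> * x + 2 * D * (E * M powr p + 2 * g))"
          using E \<theta> D g x by (subst (asm) ennreal_le_iff) auto
        then have "(1 - \<theta>) * x \<le> (E + 2 * D * E) * M powr p + 4 * D * g" by (simp add: algebra_simps)
        then have "x \<le> ((E + 2 * D * E) * M powr p + 4 * D * g) / (1 - \<theta>)"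
          using \<theta> by (simp add: field_simps)
        also have "\<dots> = (E + 2 * D * E) / (1 - \<theta>) * M powr p + 4 * D / (1 - \<theta>) * g"
          using add_divide_distrib[of "(E + 2 * D * E) * M powr p" "4 * D * g" "1 - \<theta>"]
          by (simp only: times_divide_eq_left)
        finally show ?thesis using x g E D \<theta>
          by (simp add: ennreal_mult'[symmetric] ennreal_plus[symmetric] ennreal_leI del: ennreal_plus)
      qed
    qed
    have "J \<phi> {0..<1} \<le> ennreal (((E + 2 * D * E) / (1 - \<theta>)) * M powr p) + ennreal (4 * D / (1 - \<theta>)) * ?G"
    proof -
      \<comment> \<open>as \<open>R n\<close> increases to 1, monotone convergence is continuity from below of the measure \<open>N\<close>\<close>
      define R where "R = (\<lambda>n::nat. 1 - 1 / real (n + 2))"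
      define N where "N = density lborel (\<lambda>r. ennreal (\<phi> r powr p * (1 - r) powr a))"
      have J_N: "J \<phi> A = emeasure N A" if "A \<in> sets borel" for A
        unfolding J_def N_def using that by (subst emeasure_density) auto
      have "(\<Union>n. {0..<R n}) = {0..<1}"
      proof (intro equalityI subsetI)
        fix x assume x: "x \<in> {0..<1::real}"
        then obtain n where "inverse (real (Suc n)) < 1 - x" using reals_Archimedean[of "1 - x"] by auto
        moreover have "1 / real (n + 2) \<le> inverse (real (Suc n))" by (simp add: field_simps)
        ultimately have "x < R n" unfolding R_def by linarith
        then show "x \<in> (\<Union>n. {0..<R n})" using x by auto
      next
        fix x assume "x \<in> (\<Union>n. {0..<R n})"
        then obtain n where "0 \<le> x" "x < R n" by auto
        moreover have "R n < 1" by (simp add: R_def)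
        ultimately show "x \<in> {0..<1}" by simp
      qed
      moreover have "incseq (\<lambda>n. {0..<R n})"
      proof (intro incseq_SucI)
        fix n
        have "1 / real (Suc n + 2) \<le> 1 / real (n + 2)" by (intro divide_left_mono) auto
        then have "R n \<le> R (Suc n)" unfolding R_def by linarith
        then show "{0..<R n} \<le> {0..<R (Suc n)}" by auto
      qed
      ultimately have "J \<phi> {0..<1} = (SUP n. J \<phi> {0..<R n})"
        using SUP_emeasure_incseq[of "\<lambda>n. {0..<R n}" N] by (simp add: J_N N_def image_subset_iff)
      also have "\<dots> \<le> ennreal (((E + 2 * D * E) / (1 - \<theta>)) * M powr p) + ennreal (4 * D / (1 - \<theta>)) * ?G"
      proof (rule SUP_least)
        fix n show "J \<phi> {0..<R n} \<le> ennreal (((E + 2 * D * E) / (1 - \<theta>)) * M powr p) + ennreal (4 * D / (1 - \<theta>)) * ?G"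
          by (rule trunc) (auto simp: R_def field_simps)
      qed
      finally show ?thesis .
    qed
    moreover have "(\<integral>\<^sup>+r. ennreal (r * \<phi> r powr p * (1 - r) powr a) * indicator {0<..<1} r \<partial>lborel) \<le> J \<phi> {0..<1}"
      unfolding J_def
    proof (rule nn_integral_mono)
      fix r :: real
      show "ennreal (r * \<phi> r powr p * (1 - r) powr a) * indicator {0<..<1} r
         \<le> ennreal (\<phi> r powr p * (1 - r) powr a) * indicator {0..<1} r"
      proof (cases "r \<in> {0<..<1}")
        case True
        then have "r * (\<phi> r powr p * (1 - r) powr a) \<le> 1 * (\<phi> r powr p * (1 - r) powr a)"
          by (intro mult_right_mono) auto
        then show ?thesis using True by (simp add: mult.assoc ennreal_leI)
      qed simp
    qed
    ultimately show "(\<integral>\<^sup>+r. ennreal (r * \<phi> r powr p * (1 - r) powr a) * indicator {0<..<1} r \<partial>lborel)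
        \<le> ennreal ((E + 2 * D * E) / (1 - \<theta>) * M powr p) + ennreal (4 * D / (1 - \<theta>)) * ?G"
      by (rule order_trans[rotated])
  qed
qed

text \<open>The Hardy inequality on every ray gives the integrability of \<open>f\<close> from that of a bound \<open>G\<close> for the
differences of \<open>f\<close> between points whose distances to the boundary have ratio 2.\<close>

lemma disk_Lp_by_radial_differences:
  fixes f :: "complex \<Rightarrow> complex" and G :: "complex \<Rightarrow> real"
  assumes p: "0 < p" and \<alpha>: "-1 < \<alpha>"
    and f: "continuous_on unit_disk f" and G: "continuous_on unit_disk G"
    and G0: "\<And>z. z \<in> unit_disk \<Longrightarrow> 0 \<le> G z"
    and step: "\<And>v r. \<lbrakk>cmod v = 1; 1/2 \<le> r; r < 1\<rbrakk> \<Longrightarrow>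
        cmod (f (r *\<^sub>R v) - f ((2 * r - 1) *\<^sub>R v)) \<le> G (r *\<^sub>R v) + G ((2 * r - 1) *\<^sub>R v)"
    and fin: "disk_Lp_integral p \<alpha> G < \<infinity>"
  shows "disk_Lp_integral p \<alpha> f < \<infinity>"
proof -
  obtain K L where KL: "0 \<le> K" "0 \<le> L"
    and hardy: "\<forall>\<phi> \<gamma> M. radial_control \<phi> \<gamma> M \<longrightarrow>
      (\<integral>\<^sup>+r. ennreal (r * \<phi> r powr p * (1 - r) powr \<alpha>) * indicator {0<..<1} r \<partial>lborel)
        \<le> ennreal (K * M powr p) + ennreal L *
          (\<integral>\<^sup>+r. ennreal (r * \<gamma> r powr p * (1 - r) powr \<alpha>) * indicator {0<..<1} r \<partial>lborel)"
    using radial_hardy_inequality[OF p \<alpha>] by (elim exE conjE)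
  have sub: "cball 0 R \<subseteq> unit_disk" if "R < 1" for R :: real using that by auto
  have bounded: "\<exists>B. \<forall>z\<in>cball 0 R. norm (h z) \<le> B"
    if "R < 1" "continuous_on unit_disk h" for R and h :: "complex \<Rightarrow> 'b::real_normed_vector"
  proof -
    have "compact (h ` cball 0 R)"
      using continuous_on_subset[OF that(2) sub[OF that(1)]] by (intro compact_continuous_image) auto
    then have "bounded (h ` cball 0 R)" by (rule compact_imp_bounded)
    then show ?thesis by (simp add: bounded_iff)
  qed
  obtain M1 where M1: "\<forall>z\<in>cball 0 (1/2). norm (f z) \<le> M1" using bounded[OF _ f, of "1/2"] by auto
  obtain M2 where M2: "\<forall>z\<in>cball 0 (1/2). norm (G z) \<le> M2" using bounded[OF _ G, of "1/2"] by auto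
  define M where "M = max M1 M2"
  define dens where "dens = (\<lambda>(h::complex \<Rightarrow> real) z.
    ennreal (h z powr p * (1 - cmod z) powr \<alpha>) * indicator unit_disk z)"
  have dens_meas: "dens h \<in> borel_measurable borel"
    if "continuous_on unit_disk h" "\<And>z. z \<in> unit_disk \<Longrightarrow> 0 \<le> h z" for h
  proof -
    have "continuous_on unit_disk (\<lambda>z. h z powr p * (1 - cmod z) powr \<alpha>)"
      using that p by (intro continuous_intros continuous_on_powr') auto
    then show ?thesis unfolding dens_def by (rule borel_measurable_on_disk)
  qed
  \<comment> \<open>extension by zero makes the restriction to a ray measurable on the whole line\<close>
  define ray where "ray = (\<lambda>(h::complex \<Rightarrow> real) v r. indicator {0..<1} r * h (r *\<^sub>R v))"
  have ray_dens: "(\<integral>\<^sup>+r. ennreal r * dens h (r *\<^sub>R v) * indicator {0<..} r \<partial>lborel)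
      = (\<integral>\<^sup>+r. ennreal (r * ray h v r powr p * (1 - r) powr \<alpha>) * indicator {0<..<1} r \<partial>lborel)"
    if "cmod v = 1" for h v
    using that by (intro nn_integral_cong)
      (auto simp: dens_def ray_def indicator_def ennreal_mult mult.assoc)
  have ray_meas: "ray h v \<in> borel_measurable borel"
    if "cmod v = 1" "continuous_on unit_disk h" for h v
  proof -
    have "continuous_on {0..<1} (\<lambda>r. h (r *\<^sub>R v))"
      using that(1) by (intro continuous_on_compose2[OF that(2)] continuous_intros) auto
    then show ?thesis
      using borel_measurable_continuous_on_indicator[of "{0..<1::real}" "\<lambda>r. h (r *\<^sub>R v)"]
      by (simp add: ray_def)
  qed
  have F: "continuous_on unit_disk (\<lambda>z. cmod (f z))" using f by (intro continuous_intros)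
  have "(\<integral>\<^sup>+z. dens (\<lambda>z. cmod (f z)) z \<partial>lborel) < \<infinity>"
  proof (rule nn_integral_complex_finite_by_rays)
    show "dens (\<lambda>z. cmod (f z)) \<in> borel_measurable borel" "dens G \<in> borel_measurable borel"
      using dens_meas F G G0 by auto
    have "dens G z = ennreal (norm (G z) powr p * (1 - cmod z) powr \<alpha>) * indicator unit_disk z" for z
      using G0[of z] by (auto simp: dens_def indicator_def)
    then show "(\<integral>\<^sup>+z. dens G z \<partial>lborel) < \<infinity>"
      using fin by (simp add: disk_Lp_integral_def)
    fix v :: complex assume v: "cmod v = 1"
    have "(\<integral>\<^sup>+r. ennreal (r * ray (\<lambda>z. cmod (f z)) v r powr p * (1 - r) powr \<alpha>) * indicator {0<..<1} r \<partial>lborel)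
       \<le> ennreal (K * M powr p) + ennreal L *
          (\<integral>\<^sup>+r. ennreal (r * ray G v r powr p * (1 - r) powr \<alpha>) * indicator {0<..<1} r \<partial>lborel)"
    proof (rule hardy[rule_format], unfold radial_control_def, intro conjI allI ballI impI)
      show "ray (\<lambda>z. cmod (f z)) v \<in> borel_measurable borel" "ray G v \<in> borel_measurable borel"
        using ray_meas[OF v] F G by auto
      show "0 \<le> ray (\<lambda>z. cmod (f z)) v r" for r by (simp add: ray_def)
      show "0 \<le> ray G v r" for r using G0[of "r *\<^sub>R v"] v by (auto simp: ray_def indicator_def)
      show "\<exists>B. \<forall>r\<in>{0..R}. ray (\<lambda>z. cmod (f z)) v r \<le> B" if R: "R < 1" for R
      proof -
        obtain B where "\<forall>z\<in>cball 0 R. norm (f z) \<le> B" using bounded[OF R f] by auto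
        then have "\<forall>r\<in>{0..R}. ray (\<lambda>z. cmod (f z)) v r \<le> B" using v R by (auto simp: ray_def)
        then show ?thesis ..
      qed
      show "ray (\<lambda>z. cmod (f z)) v r \<le> M" "ray G v r \<le> M" if "r \<in> {0..1/2}" for r
      proof -
        have "r *\<^sub>R v \<in> cball 0 (1/2)" using that v by simp
        then have "norm (f (r *\<^sub>R v)) \<le> M1" "norm (G (r *\<^sub>R v)) \<le> M2" using M1 M2 by blast+
        then show "ray (\<lambda>z. cmod (f z)) v r \<le> M" "ray G v r \<le> M" using that by (auto simp: ray_def M_def)
      qed
      fix r :: real assume r: "r \<in> {1/2..<1}"
      have "cmod (f (r *\<^sub>R v)) \<le> cmod (f ((2*r-1) *\<^sub>R v)) + cmod (f (r *\<^sub>R v) - f ((2*r-1) *\<^sub>R v))"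
        by (rule norm_triangle_sub)
      also have "\<dots> \<le> cmod (f ((2*r-1) *\<^sub>R v)) + (G (r *\<^sub>R v) + G ((2*r-1) *\<^sub>R v))"
        using step[OF v, of r] r by simp
      finally show "ray (\<lambda>z. cmod (f z)) v r
          \<le> ray (\<lambda>z. cmod (f z)) v (2 * r - 1) + (ray G v r + ray G v (2 * r - 1))"
        using r by (simp add: ray_def)
    qed
    then show "(\<integral>\<^sup>+r. ennreal r * dens (\<lambda>z. cmod (f z)) (r *\<^sub>R v) * indicator {0<..} r \<partial>lborel)
        \<le> ennreal (K * M powr p) + ennreal L * (\<integral>\<^sup>+r. ennreal r * dens G (r *\<^sub>R v) * indicator {0<..} r \<partial>lborel)"
      by (simp add: ray_dens[OF v])
  qed
  then show ?thesis by (simp add: disk_Lp_integral_def dens_def)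
qed

section \<open>The pseudo-hyperbolic and the hyperbolic distance\<close>

text \<open>The upper bound comes from \<open>1 - \<close>cnj\<open> z w = (1 - |z|\<^sup>2) + \<close>cnj\<open> z (z - w)\<close>.\<close>

lemma one_minus_cnj_mult_bounds:
  assumes "z \<in> unit_disk" "w \<in> unit_disk"
  shows "1 - cmod z \<le> cmod (1 - cnj z * w)" "1 - cmod w \<le> cmod (1 - cnj z * w)"
    and "cmod (1 - cnj z * w) \<le> 2 * (1 - cmod z) + cmod (z - w)"
proof -
  have le: "cmod z * cmod w \<le> cmod z" "cmod z * cmod w \<le> cmod w"
    using assms by (auto intro!: mult_left_le mult_left_le_one_le)
  have "1 - cmod z * cmod w \<le> cmod (1 - cnj z * w)"
    using norm_triangle_ineq2[of 1 "cnj z * w"] by (simp add: norm_mult)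
  then show "1 - cmod z \<le> cmod (1 - cnj z * w)" "1 - cmod w \<le> cmod (1 - cnj z * w)"
    using le by linarith+
  have "1 - cnj z * w = complex_of_real (1 - (cmod z)\<^sup>2) + cnj z * (z - w)"
    using complex_norm_square[of z] by (simp add: algebra_simps)
  then have "cmod (1 - cnj z * w) \<le> cmod (complex_of_real (1 - (cmod z)\<^sup>2)) + cmod (cnj z * (z - w))"
    by (metis norm_triangle_ineq)
  also have "cmod (complex_of_real (1 - (cmod z)\<^sup>2)) = 1 - (cmod z)\<^sup>2"
    using assms by (simp only: norm_of_real) (simp add: power_le_one abs_square_le_1)
  also have "cmod (cnj z * (z - w)) \<le> cmod (z - w)"
    using assms by (simp add: norm_mult mult_left_le_one_le)
  also have "1 - (cmod z)\<^sup>2 \<le> 2 * (1 - cmod z)"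
    using zero_le_power2[of "1 - cmod z"] by (simp add: power2_eq_square algebra_simps)
  finally show "cmod (1 - cnj z * w) \<le> 2 * (1 - cmod z) + cmod (z - w)" by simp
qed

lemma pseudo_hyperbolic_dist_bounds:
  assumes "z \<in> unit_disk" "w \<in> unit_disk"
  shows pseudo_hyperbolic_dist_nonneg: "0 \<le> pseudo_hyperbolic_dist z w"
    and pseudo_hyperbolic_dist_less_1: "pseudo_hyperbolic_dist z w < 1"
    and pseudo_hyperbolic_dist_le_left: "pseudo_hyperbolic_dist z w \<le> cmod (z - w) / (1 - cmod z)"
    and pseudo_hyperbolic_dist_le_right: "pseudo_hyperbolic_dist z w \<le> cmod (z - w) / (1 - cmod w)"
    and pseudo_hyperbolic_dist_ge:
      "cmod (z - w) / (2 * (1 - cmod z) + cmod (z - w)) \<le> pseudo_hyperbolic_dist z w"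
proof -
  note b = one_minus_cnj_mult_bounds[OF assms]
  have pos: "0 < 1 - cmod z" "0 < 1 - cmod w" using assms by auto
  then have d: "0 < cmod (1 - cnj z * w)" using b by linarith
  show "0 \<le> pseudo_hyperbolic_dist z w" by (simp add: pseudo_hyperbolic_dist_def)
  show "pseudo_hyperbolic_dist z w \<le> cmod (z - w) / (1 - cmod z)"
    "pseudo_hyperbolic_dist z w \<le> cmod (z - w) / (1 - cmod w)"
    unfolding pseudo_hyperbolic_dist_def norm_divide using b pos by (intro divide_left_mono mult_pos_pos d; simp)+
  show "cmod (z - w) / (2 * (1 - cmod z) + cmod (z - w)) \<le> pseudo_hyperbolic_dist z w"
    unfolding pseudo_hyperbolic_dist_def norm_divide using b pos d by (intro divide_left_mono mult_pos_pos) auto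
  \<comment> \<open>the identity behind the invariance of the pseudo-hyperbolic distance\<close>
  have "(cmod (1 - cnj z * w))\<^sup>2 - (cmod (z - w))\<^sup>2 = (1 - (cmod z)\<^sup>2) * (1 - (cmod w)\<^sup>2)"
    by (simp add: cmod_power2) (simp add: power2_eq_square algebra_simps)
  moreover have "0 < (1 - (cmod z)\<^sup>2) * (1 - (cmod w)\<^sup>2)"
    using assms by (intro mult_pos_pos) (auto simp: abs_square_less_1)
  ultimately have "(cmod (z - w))\<^sup>2 < (cmod (1 - cnj z * w))\<^sup>2" by linarith
  then have "cmod (z - w) < cmod (1 - cnj z * w)" by (rule power2_less_imp_less) simp
  then show "pseudo_hyperbolic_dist z w < 1"
    unfolding pseudo_hyperbolic_dist_def norm_divide using d by simp
qed

text \<open>The right-hand side is the inverse hyperbolic tangent, whose derivative \<open>1 / (1 - x\<^sup>2)\<close> is at least 1;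
hence the pseudo-hyperbolic distance is at most the hyperbolic one.\<close>

lemma le_half_ln_ratio:
  fixes x :: real
  assumes "0 \<le> x" "x < 1"
  shows "x \<le> 1 / 2 * ln ((1 + x) / (1 - x))"
proof -
  have "x \<le> artanh x"
  proof -
    have "artanh 0 - 0 \<le> artanh x - x"
    proof (rule DERIV_nonneg_imp_nondecreasing[OF assms(1)])
      fix y assume y: "0 \<le> y" "y \<le> x"
      then have y1: "\<bar>y\<bar> < 1" using assms by auto
      then have "((\<lambda>x. artanh x - x) has_real_derivative 1 / (1 - y\<^sup>2) - 1) (at y)"
        by (auto intro!: derivative_eq_intros)
      moreover have "0 \<le> 1 / (1 - y\<^sup>2) - 1"
        using y1 by (simp add: field_simps abs_square_less_1)
      ultimately show "\<exists>d. ((\<lambda>x. artanh x - x) has_real_derivative d) (at y) \<and> 0 \<le> d" by blast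
    qed
    then show ?thesis by simp
  qed
  then show ?thesis by (simp add: artanh_def)
qed

section \<open>Domination of differences and integrability\<close>

text \<open>The function \<open>g\<close> is a multiple of \<open>local_sup f\<close>. If \<open>|z - w|\<close> is at most \<open>(1 - |z|) / 4\<close>, the Lipschitz
bound on the disc of the local supremum applies and \<open>|z - w| / (1 - |z|)\<close> is at most \<open>9/4\<close> times the
pseudo-hyperbolic distance. Otherwise that distance is at least \<open>1/9\<close>, and the triangle inequality
is enough.\<close>

lemma bergman_pseudo_hyperbolic_modulus:
  assumes p: "0 < p" and hol: "f holomorphic_on unit_disk"
    and fin: "disk_Lp_integral p \<alpha> f < \<infinity>"
  shows "\<exists>g :: complex \<Rightarrow> real. continuous_on unit_disk g \<and> disk_Lp_integral p \<alpha> g < \<infinity> \<and>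
    (\<forall>z\<in>unit_disk. 0 \<le> g z) \<and>
    (\<forall>z\<in>unit_disk. \<forall>w\<in>unit_disk. cmod (f z - f w) \<le> pseudo_hyperbolic_dist z w * (g z + g w))"
proof -
  have f: "continuous_on unit_disk f" by (rule holomorphic_on_imp_continuous_on[OF hol])
  have cont: "continuous_on unit_disk (local_sup f)" by (rule continuous_on_local_sup[OF f])
  have up: "cmod (f v) \<le> local_sup f z" if "z \<in> unit_disk" "v \<in> cball z ((1 - cmod z) / 2)" for z v
    using local_sup_attained[OF f that(1)] that(2) by metis
  have self: "cmod (f z) \<le> local_sup f z" if "z \<in> unit_disk" for z
    using up[OF that, of z] that by simp
  have nonneg: "0 \<le> local_sup f z" if "z \<in> unit_disk" for z
    using self[OF that] norm_ge_zero order_trans by blast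
  show ?thesis
  proof (intro exI[of _ "\<lambda>z. 18 * local_sup f z"] conjI ballI)
    show "continuous_on unit_disk (\<lambda>z. 18 * local_sup f z)" by (intro continuous_intros cont)
    show "0 \<le> 18 * local_sup f z" if "z \<in> unit_disk" for z using nonneg[OF that] by simp
    show "disk_Lp_integral p \<alpha> (\<lambda>z. 18 * local_sup f z) < \<infinity>"
    proof (rule disk_Lp_integral_finite_mono[OF p cont _ local_sup_in_Lp[OF p hol fin], of "18 powr p"])
      fix z
      show "norm (18 * local_sup f z) powr p * (1 - cmod z) powr \<alpha>
        \<le> 18 powr p * (norm (local_sup f z) powr p * (1 - cmod z) powr \<alpha>)"
        by (simp add: abs_mult powr_mult)
    qed simp
    fix z w assume z: "z \<in> unit_disk" and w: "w \<in> unit_disk"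
    let ?s = "1 - cmod z" and ?d = "cmod (z - w)" and ?\<rho> = "pseudo_hyperbolic_dist z w"
    have s: "0 < ?s" using z by simp
    have ge: "?d / (2 * ?s + ?d) \<le> ?\<rho>" by (rule pseudo_hyperbolic_dist_ge[OF z w])
    show "cmod (f z - f w) \<le> ?\<rho> * (18 * local_sup f z + 18 * local_sup f w)"
    proof (cases "?d \<le> ?s / 4")
      case True
      have "ball z (?s / 2) \<subseteq> unit_disk"
      proof
        fix v assume "v \<in> ball z (?s / 2)"
        then have "cmod (v - z) < ?s / 2" by (simp add: dist_norm norm_minus_commute)
        moreover have "cmod v \<le> cmod z + cmod (v - z)" by (rule norm_triangle_sub)
        ultimately show "v \<in> unit_disk" using s by simp
      qed
      then have "f holomorphic_on ball z (?s / 2)" using hol holomorphic_on_subset by blast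
      then have "cmod (f w - f z) \<le> 4 * local_sup f z / (?s / 2) * cmod (w - z)"
      proof (rule holomorphic_lipschitz_half_ball)
        show "cmod (f v) \<le> local_sup f z" if "v \<in> ball z (?s / 2)" for v
          using up[OF z, of v] that by simp
        show "cmod (w - z) \<le> ?s / 2 / 2" using True by (simp add: norm_minus_commute)
      qed (use s in simp)
      then have "cmod (f z - f w) \<le> 8 * local_sup f z * (?d / ?s)"
        by (simp add: norm_minus_commute)
      also have "\<dots> \<le> 8 * local_sup f z * (9/4 * ?\<rho>)"
      proof (rule mult_left_mono)
        have "?d / ?s = 9/4 * (?d / (9/4 * ?s))"
          by (subst times_divide_eq_right, subst mult_divide_mult_cancel_left) simp_all
        also have "\<dots> \<le> 9/4 * (?d / (2 * ?s + ?d))"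
          using s True by (intro mult_left_mono divide_left_mono mult_pos_pos add_pos_nonneg) auto
        also have "\<dots> \<le> 9/4 * ?\<rho>" using ge by (rule mult_left_mono) simp
        finally show "?d / ?s \<le> 9/4 * ?\<rho>" .
      qed (use nonneg[OF z] in simp)
      finally have "cmod (f z - f w) \<le> ?\<rho> * (18 * local_sup f z)" by (simp add: mult_ac)
      also have "\<dots> \<le> ?\<rho> * (18 * local_sup f z + 18 * local_sup f w)"
        using nonneg[OF w] pseudo_hyperbolic_dist_nonneg[OF z w] by (intro mult_left_mono) auto
      finally show ?thesis .
    next
      case False
      have "1 / 9 \<le> ?d / (2 * ?s + ?d)" using False s by (simp add: field_simps)
      then have \<rho>: "1 \<le> 9 * ?\<rho>" using ge by linarith
      have "cmod (f z - f w) \<le> local_sup f z + local_sup f w"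
        using norm_triangle_ineq4[of "f z" "f w"] self[OF z] self[OF w] by linarith
      also have "\<dots> \<le> 18 * ?\<rho> * (local_sup f z + local_sup f w)"
        using mult_right_mono[of 1 "18 * ?\<rho>" "local_sup f z + local_sup f w"] \<rho> nonneg[OF z] nonneg[OF w] by simp
      finally show ?thesis by (simp add: algebra_simps)
    qed
  qed
qed

lemma pseudo_hyperbolic_dist_radial_le_half:
  assumes "cmod v = 1" "1/2 \<le> r" "r < 1"
  shows "pseudo_hyperbolic_dist (r *\<^sub>R v) ((2 * r - 1) *\<^sub>R v) \<le> 1/2"
proof -
  have "cnj v * v = 1" using assms(1) complex_norm_square[of v] by (simp add: mult.commute)
  then have "cnj (r *\<^sub>R v) * ((2 * r - 1) *\<^sub>R v) = complex_of_real (r * (2 * r - 1))"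
    by (simp add: scaleR_conv_of_real)
  then have "1 - cnj (r *\<^sub>R v) * ((2 * r - 1) *\<^sub>R v) = complex_of_real ((1 - r) * (1 + 2 * r))"
    by (simp add: algebra_simps)
  moreover have "r *\<^sub>R v - (2 * r - 1) *\<^sub>R v = (1 - r) *\<^sub>R v" by (simp flip: scaleR_left_diff_distrib)
  ultimately have "pseudo_hyperbolic_dist (r *\<^sub>R v) ((2 * r - 1) *\<^sub>R v) = (1 - r) / ((1 - r) * (1 + 2 * r))"
    unfolding pseudo_hyperbolic_dist_def norm_divide using assms by (simp only: norm_of_real norm_scaleR) simp
  also have "\<dots> = 1 / (1 + 2 * r)" using assms by simp
  also have "\<dots> \<le> 1/2" using assms by (simp add: field_simps)
  finally show ?thesis .
qed

text \<open>Only the distance of points \<open>r v\<close> and \<open>(2 r - 1) v\<close> matters for integrability. It is bounded for the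
hyperbolic and the pseudo-hyperbolic metric alike, so one argument serves both.\<close>

lemma disk_Lp_by_bounded_radial_steps:
  fixes g :: "complex \<Rightarrow> real" and \<delta> :: "complex \<Rightarrow> complex \<Rightarrow> real"
  assumes p: "0 < p" and \<alpha>: "-1 < \<alpha>" and f: "continuous_on unit_disk f"
    and g: "continuous_on unit_disk g" and fin: "disk_Lp_integral p \<alpha> g < \<infinity>"
    and \<delta>: "\<And>v r. \<lbrakk>cmod v = 1; 1/2 \<le> r; r < 1\<rbrakk> \<Longrightarrow>
        0 \<le> \<delta> (r *\<^sub>R v) ((2 * r - 1) *\<^sub>R v) \<and> \<delta> (r *\<^sub>R v) ((2 * r - 1) *\<^sub>R v) \<le> 1"
    and le: "\<And>z w. \<lbrakk>z \<in> unit_disk; w \<in> unit_disk\<rbrakk> \<Longrightarrow> cmod (f z - f w) \<le> \<delta> z w * (g z + g w)"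
  shows "disk_Lp_integral p \<alpha> f < \<infinity>"
proof (rule disk_Lp_by_radial_differences[OF p \<alpha> f, of "\<lambda>z. \<bar>g z\<bar>"])
  show "continuous_on unit_disk (\<lambda>z. \<bar>g z\<bar>)" using g by (intro continuous_intros)
  show "disk_Lp_integral p \<alpha> (\<lambda>z. \<bar>g z\<bar>) < \<infinity>" using fin by (simp add: disk_Lp_integral_def)
  fix v :: complex and r :: real
  assume v: "cmod v = 1" and r: "1/2 \<le> r" "r < 1"
  let ?z = "r *\<^sub>R v" and ?w = "(2 * r - 1) *\<^sub>R v"
  have "cmod (f ?z - f ?w) \<le> \<delta> ?z ?w * (g ?z + g ?w)" using v r by (intro le) auto
  also have "\<dots> \<le> \<delta> ?z ?w * (\<bar>g ?z\<bar> + \<bar>g ?w\<bar>)" using \<delta>[OF v r] by (intro mult_left_mono) auto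
  also have "\<dots> \<le> \<bar>g ?z\<bar> + \<bar>g ?w\<bar>"
    using \<delta>[OF v r] by (intro mult_left_le_one_le) auto
  finally show "cmod (f ?z - f ?w) \<le> \<bar>g ?z\<bar> + \<bar>g ?w\<bar>" .
qed simp

text \<open>The Euclidean distance of \<open>r v\<close> and \<open>(2 r - 1) v\<close> is \<open>1 - r\<close>, at most the distance of either point
to the boundary. This factor, raised to the power \<open>p\<close>, turns the weight of exponent \<open>p + \<alpha>\<close> into
that of exponent \<open>\<alpha>\<close>.\<close>

lemma bergman_if_euclidean_modulus:
  fixes g :: "complex \<Rightarrow> real"
  assumes p: "0 < p" and \<alpha>: "-1 < \<alpha>" and f: "continuous_on unit_disk f"
    and g: "continuous_on unit_disk g" and fin: "disk_Lp_integral p (p + \<alpha>) g < \<infinity>"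
    and le: "\<And>z w. \<lbrakk>z \<in> unit_disk; w \<in> unit_disk\<rbrakk> \<Longrightarrow> cmod (f z - f w) \<le> cmod (z - w) * (g z + g w)"
  shows "disk_Lp_integral p \<alpha> f < \<infinity>"
proof (rule disk_Lp_by_radial_differences[OF p \<alpha> f, of "\<lambda>z. (1 - cmod z) * \<bar>g z\<bar>"])
  show "continuous_on unit_disk (\<lambda>z. (1 - cmod z) * \<bar>g z\<bar>)" using g by (intro continuous_intros)
  show "disk_Lp_integral p \<alpha> (\<lambda>z. (1 - cmod z) * \<bar>g z\<bar>) < \<infinity>"
    by (rule disk_Lp_integral_finite_mono[OF p g _ fin, of 1])
       (auto simp: abs_mult powr_mult powr_add)
  fix v :: complex and r :: real
  assume v: "cmod v = 1" and r: "1/2 \<le> r" "r < 1"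
  let ?z = "r *\<^sub>R v" and ?w = "(2 * r - 1) *\<^sub>R v"
  have "?z - ?w = (1 - r) *\<^sub>R v" by (simp flip: scaleR_left_diff_distrib)
  then have d: "cmod (?z - ?w) = 1 - r" using v r by simp
  have "cmod (f ?z - f ?w) \<le> cmod (?z - ?w) * (g ?z + g ?w)" using v r by (intro le) auto
  also have "\<dots> \<le> (1 - r) * \<bar>g ?z\<bar> + (1 - r) * \<bar>g ?w\<bar>"
    unfolding d distrib_left[symmetric] using r by (intro mult_left_mono) auto
  also have "\<dots> \<le> (1 - r) * \<bar>g ?z\<bar> + (1 - (2 * r - 1)) * \<bar>g ?w\<bar>"
    using r by (intro add_left_mono mult_right_mono) auto
  finally show "cmod (f ?z - f ?w) \<le> (1 - cmod ?z) * \<bar>g ?z\<bar> + (1 - cmod ?w) * \<bar>g ?w\<bar>"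
    using v r by simp
qed auto

theorem theorem1:
  fixes p \<alpha> :: real and f :: "complex \<Rightarrow> complex"
  assumes "p > 0" and "\<alpha> > -1" and "f analytic_on unit_disk"
  shows "(f \<in> bergman_space p \<alpha> \<longleftrightarrow>
            (\<exists>g :: complex \<Rightarrow> real. continuous_on unit_disk g \<and> in_Lp (weighted_disk_area \<alpha>) p g \<and>
               (\<forall>z\<in>unit_disk. \<forall>w\<in>unit_disk.
                  cmod (f z - f w) \<le> pseudo_hyperbolic_dist z w * (g z + g w))))
       \<and> (f \<in> bergman_space p \<alpha> \<longleftrightarrow>
            (\<exists>g :: complex \<Rightarrow> real. continuous_on unit_disk g \<and> in_Lp (weighted_disk_area \<alpha>) p g \<and>
               (\<forall>z\<in>unit_disk. \<forall>w\<in>unit_disk.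
                  cmod (f z - f w) \<le> hyperbolic_dist z w * (g z + g w))))
       \<and> (f \<in> bergman_space p \<alpha> \<longleftrightarrow>
            (\<exists>g :: complex \<Rightarrow> real. continuous_on unit_disk g \<and> in_Lp (weighted_disk_area (p + \<alpha>)) p g \<and>
               (\<forall>z\<in>unit_disk. \<forall>w\<in>unit_disk.
                  cmod (f z - f w) \<le> cmod (z - w) * (g z + g w))))"
    (is "(?A \<longleftrightarrow> ?B) \<and> (?A \<longleftrightarrow> ?C) \<and> (?A \<longleftrightarrow> ?D)")
proof -
  have hol: "f holomorphic_on unit_disk" using assms(3) by (simp add: analytic_on_open)
  have f: "continuous_on unit_disk f" by (rule holomorphic_on_imp_continuous_on[OF hol])
  have p\<alpha>: "-1 < p + \<alpha>" using assms by simp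
  note Lp = in_Lp_weighted_disk_area_iff[OF assms(1,2)] and Lp' = in_Lp_weighted_disk_area_iff[OF assms(1) p\<alpha>]
  have A: "?A \<longleftrightarrow> disk_Lp_integral p \<alpha> f < \<infinity>"
    using assms(3) Lp[OF f] by (simp add: bergman_space_def)
  have "?B \<and> ?C \<and> ?D" if ?A
  proof -
    obtain g :: "complex \<Rightarrow> real" where g: "continuous_on unit_disk g" "disk_Lp_integral p \<alpha> g < \<infinity>"
      and g0: "\<And>z. z \<in> unit_disk \<Longrightarrow> 0 \<le> g z"
      and gle: "\<And>z w. \<lbrakk>z \<in> unit_disk; w \<in> unit_disk\<rbrakk> \<Longrightarrow> cmod (f z - f w) \<le> pseudo_hyperbolic_dist z w * (g z + g w)"
      using bergman_pseudo_hyperbolic_modulus[OF assms(1) hol] \<open>?A\<close> unfolding A by blast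
    have ?B using g gle Lp[OF g(1)] by blast
    moreover have ?C
    proof -
      have "cmod (f z - f w) \<le> hyperbolic_dist z w * (g z + g w)"
        if zw: "z \<in> unit_disk" "w \<in> unit_disk" for z w
      proof -
        have "pseudo_hyperbolic_dist z w \<le> hyperbolic_dist z w"
          unfolding hyperbolic_dist_def using pseudo_hyperbolic_dist_nonneg[OF zw] pseudo_hyperbolic_dist_less_1[OF zw]
          by (rule le_half_ln_ratio)
        then have "pseudo_hyperbolic_dist z w * (g z + g w) \<le> hyperbolic_dist z w * (g z + g w)"
          using g0[OF zw(1)] g0[OF zw(2)] by (intro mult_right_mono) auto
        then show ?thesis using gle[OF zw] by linarith
      qed
      then show ?thesis using g Lp[OF g(1)] by blast
    qed
    moreover have ?D
    proof -
      define G where "G = (\<lambda>z. g z / (1 - cmod z))"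
      have G: "continuous_on unit_disk G" unfolding G_def using g(1) by (intro continuous_intros) auto
      have "disk_Lp_integral p (p + \<alpha>) G < \<infinity>"
        by (rule disk_Lp_integral_finite_mono[OF assms(1) g(1) _ g(2), of 1])
           (auto simp: G_def powr_divide powr_add)
      moreover have "cmod (f z - f w) \<le> cmod (z - w) * (G z + G w)"
        if zw: "z \<in> unit_disk" "w \<in> unit_disk" for z w
      proof -
        have "cmod (f z - f w) \<le> pseudo_hyperbolic_dist z w * g z + pseudo_hyperbolic_dist z w * g w"
          using gle[OF zw] by (simp add: distrib_left)
        also have "\<dots> \<le> cmod (z - w) / (1 - cmod z) * g z + cmod (z - w) / (1 - cmod w) * g w"
          using zw g0 by (intro add_mono mult_right_mono pseudo_hyperbolic_dist_le_left pseudo_hyperbolic_dist_le_right) auto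
        also have "\<dots> = cmod (z - w) * (G z + G w)" by (simp add: G_def distrib_left)
        finally show ?thesis .
      qed
      ultimately show ?thesis using G Lp'[OF G] by blast
    qed
    ultimately show ?thesis by blast
  qed
  moreover have half: "0 \<le> pseudo_hyperbolic_dist (r *\<^sub>R v) ((2 * r - 1) *\<^sub>R v) \<and>
      pseudo_hyperbolic_dist (r *\<^sub>R v) ((2 * r - 1) *\<^sub>R v) \<le> 1/2"
    if "cmod v = 1" "1/2 \<le> r" "r < 1" for v r
    using pseudo_hyperbolic_dist_radial_le_half[OF that] by (simp add: pseudo_hyperbolic_dist_def)
  have ?A if ?B
  proof -
    obtain g :: "complex \<Rightarrow> real" where g: "continuous_on unit_disk g" "disk_Lp_integral p \<alpha> g < \<infinity>"
      and gle: "\<And>z w. \<lbrakk>z \<in> unit_disk; w \<in> unit_disk\<rbrakk> \<Longrightarrow> cmod (f z - f w) \<le> pseudo_hyperbolic_dist z w * (g z + g w)"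
      using \<open>?B\<close> Lp by metis
    show ?A unfolding A
      by (rule disk_Lp_by_bounded_radial_steps[OF assms(1,2) f g _ gle]) (use half in fastforce)+
  qed
  moreover have ?A if ?C
  proof -
    obtain g :: "complex \<Rightarrow> real" where g: "continuous_on unit_disk g" "disk_Lp_integral p \<alpha> g < \<infinity>"
      and gle: "\<And>z w. \<lbrakk>z \<in> unit_disk; w \<in> unit_disk\<rbrakk> \<Longrightarrow> cmod (f z - f w) \<le> hyperbolic_dist z w * (g z + g w)"
      using \<open>?C\<close> Lp by metis
    have "0 \<le> hyperbolic_dist (r *\<^sub>R v) ((2 * r - 1) *\<^sub>R v) \<and> hyperbolic_dist (r *\<^sub>R v) ((2 * r - 1) *\<^sub>R v) \<le> 1"
      if vr: "cmod v = 1" "1/2 \<le> r" "r < 1" for v r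
    proof -
      define x where "x = pseudo_hyperbolic_dist (r *\<^sub>R v) ((2 * r - 1) *\<^sub>R v)"
      have x: "0 \<le> x" "x \<le> 1/2" using half[OF vr] by (simp_all add: x_def)
      \<comment> \<open>pseudo-hyperbolic distance \<open>1/2\<close> is hyperbolic distance \<open>(ln 3) / 2\<close>, which is less than 1\<close>
      have "(1 + x) / (1 - x) \<le> 3" "0 < (1 + x) / (1 - x)" using x by (simp_all add: field_simps)
      then have "ln ((1 + x) / (1 - x)) \<le> 2" using ln_le_minus_one[of "(1 + x) / (1 - x)"] by linarith
      moreover have "x \<le> 1 / 2 * ln ((1 + x) / (1 - x))" using x by (intro le_half_ln_ratio) auto
      ultimately show ?thesis using x unfolding hyperbolic_dist_def x_def[symmetric] by linarith
    qed
    then show ?A unfolding A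
      by (intro disk_Lp_by_bounded_radial_steps[OF assms(1,2) f g _ gle])
  qed
  moreover have ?A if ?D
  proof -
    obtain g :: "complex \<Rightarrow> real" where g: "continuous_on unit_disk g" "disk_Lp_integral p (p + \<alpha>) g < \<infinity>"
      and gle: "\<And>z w. \<lbrakk>z \<in> unit_disk; w \<in> unit_disk\<rbrakk> \<Longrightarrow> cmod (f z - f w) \<le> cmod (z - w) * (g z + g w)"
      using \<open>?D\<close> Lp' by metis
    show ?A unfolding A by (rule bergman_if_euclidean_modulus[OF assms(1,2) f g gle])
  qed
  ultimately show ?thesis by blast
qed

end
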